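(* (i) The statement "$\mathrm{N}(k)<+\infty$ for every $k\in\mathbb{N}$" is equivalent to "for every integer $k\ge 3$, $\sup\{n(F): F$ an nfs-irreducible clause-irreducible unsatisfiable hitting clause-set with $\delta(F)=k\}<+\infty$". (ii) The statement "$\mathrm{N}(k)=4k-5$ for every integer $k\ge2$" is equivalent to "for every integer $k\ge3$, every nfs-irreducible clause-irreducible unsatisfiable hitting clause-set $F$ with $\delta(F)=k$ satisfies $n(F)\le 4k-5$".
   Context: Variables are positive integers, literals are nonzero integers, the complement of $x$ is $\overline{x}=-x$, $\mathrm{var}(x)=|x|$. A clause is a finite set of literals with no pair $x,\overline{x}$. A clause-set is a finite set of clauses; $\top$ is the empty clause-set. $n(F)$ is the number of variables occurring in $F$, $c(F)=|F|$, $\delta(F)=c(F)-n(F)$. $F$ is satisfiable if some clause meets every clause of $F$, otherwise unsatisfiable. $F$ is hitting if any two distinct clauses $C,D\in F$ have some $x\in C$ with $\overline{x}\in D$. $\mathrm{ldeg}_F(x)$ is the number of clauses containing $x$; a variable $v$ of $F$ is singular if $\min(\mathrm{ldeg}_F(v),\mathrm{ldeg}_F(\overline v))=1$; $F$ is nonsingular if it has none. $\mathrm{N}(k)\in\mathbb{N}_0\cup\{+\infty\}$ is the supremum of $n(F)$ over nonsingular unsatisfiable hitting clause-sets with $\delta(F)=k$. A clause-set $F'\ne\top$ is a clause-factor if $\{D\setminus\bigcap F':D\in F'\}$ is unsatisfiable; a clause-factor of $F$ is a subset of $F$ that is a clause-factor; trivial if $c(F')=1$ or ($F'$ unsatisfiable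 and $F'=F$). $F$ is clause-irreducible if all its clause-factors are trivial, else clause-reducible. An nfs-pair is $\{E\cup\{x\},E\cup\{\overline{x},y\}\}$ with $E$ a clause, $\mathrm{var}(x)\ne\mathrm{var}(y)$, $x,\overline x,y,\overline y\notin E$; its nfs-flip is $\{E\cup\{x,\overline y\},E\cup\{y\}\}$. An nfs-flip on $F$ replaces an nfs-pair $P\subseteq F$, neither of whose flip clauses lies in $F$, by its nfs-flip. A clause-irreducible unsatisfiable hitting clause-set is nfs-irreducible if no finite sequence of nfs-flips transforms it into a clause-reducible clause-set. *)

theory Defs
  imports Main "HOL-Library.Extended_Nat"
begin

text \<open>Literals are nonzero integers, complementation is negation, and the variable underlying
  a literal is its absolute value.\<close>

definition clause :: "int set \<Rightarrow> bool" where
  "clause C \<longleftrightarrow> finite C \<and> 0 \<notin> C \<and> (\<forall>x\<in>C. - x \<notin> C)"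

definition clause_set :: "int set set \<Rightarrow> bool" where
  "clause_set F \<longleftrightarrow> finite F \<and> (\<forall>C\<in>F. clause C)"

definition vars :: "int set set \<Rightarrow> int set" where
  "vars F = abs ` \<Union>F"

definition nvars :: "int set set \<Rightarrow> nat" where
  "nvars F = card (vars F)"

definition deficiency :: "int set set \<Rightarrow> int" where
  "deficiency F = int (card F) - int (nvars F)"

definition satisfiable :: "int set set \<Rightarrow> bool" where
  "satisfiable F \<longleftrightarrow> (\<exists>C. clause C \<and> (\<forall>D\<in>F. C \<inter> D \<noteq> {}))"

definition hitting :: "int set set \<Rightarrow> bool" where
  "hitting F \<longleftrightarrow> (\<forall>C\<in>F. \<forall>D\<in>F. C \<noteq> D \<longrightarrow> (\<exists>x\<in>C. - x \<in> D))"

definition unsat_hitting :: "int set set \<Rightarrow> bool" where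
  "unsat_hitting F \<longleftrightarrow> clause_set F \<and> \<not> satisfiable F \<and> hitting F"

definition ldeg :: "int set set \<Rightarrow> int \<Rightarrow> nat" where
  "ldeg F x = card {C\<in>F. x \<in> C}"

definition singular_var :: "int set set \<Rightarrow> int \<Rightarrow> bool" where
  "singular_var F v \<longleftrightarrow> v \<in> vars F \<and> min (ldeg F v) (ldeg F (- v)) = 1"

definition nonsingular :: "int set set \<Rightarrow> bool" where
  "nonsingular F \<longleftrightarrow> (\<forall>v. \<not> singular_var F v)"

definition max_nvars :: "nat \<Rightarrow> enat" where
  "max_nvars k =
    (SUP F\<in>{F. unsat_hitting F \<and> nonsingular F \<and> deficiency F = int k}. enat (nvars F))"

definition clause_factor :: "int set set \<Rightarrow> bool" where
  "clause_factor F' \<longleftrightarrow>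
    clause_set F' \<and> F' \<noteq> {} \<and> \<not> satisfiable ((\<lambda>D. D - \<Inter>F') ` F')"

definition clause_factor_of :: "int set set \<Rightarrow> int set set \<Rightarrow> bool" where
  "clause_factor_of F' F \<longleftrightarrow> F' \<subseteq> F \<and> clause_factor F'"

definition trivial_factor_of :: "int set set \<Rightarrow> int set set \<Rightarrow> bool" where
  "trivial_factor_of F' F \<longleftrightarrow> card F' = 1 \<or> (\<not> satisfiable F' \<and> F' = F)"

definition clause_irreducible :: "int set set \<Rightarrow> bool" where
  "clause_irreducible F \<longleftrightarrow> (\<forall>F'. clause_factor_of F' F \<longrightarrow> trivial_factor_of F' F)"

abbreviation clause_reducible :: "int set set \<Rightarrow> bool" where
  "clause_reducible F \<equiv> \<not> clause_irreducible F"

text \<open>The parameters \<open>E, x, y\<close> are uniquely determined by the pair itself, since its two clauses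
  have different sizes; hence the flip, taken below in terms of \<open>E, x, y\<close>, is a function of the
  pair.\<close>

definition nfs_params :: "int set \<Rightarrow> int \<Rightarrow> int \<Rightarrow> bool" where
  "nfs_params E x y \<longleftrightarrow> clause E \<and> x \<noteq> 0 \<and> y \<noteq> 0 \<and> \<bar>x\<bar> \<noteq> \<bar>y\<bar> \<and>
    x \<notin> E \<and> - x \<notin> E \<and> y \<notin> E \<and> - y \<notin> E"

definition nfs_pair :: "int set \<Rightarrow> int \<Rightarrow> int \<Rightarrow> int set set" where
  "nfs_pair E x y = {E \<union> {x}, E \<union> {- x, y}}"

definition nfs_flip :: "int set \<Rightarrow> int \<Rightarrow> int \<Rightarrow> int set set" where
  "nfs_flip E x y = {E \<union> {x, - y}, E \<union> {y}}"

definition nfs_step :: "int set set \<Rightarrow> int set set \<Rightarrow> bool" where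
  "nfs_step F G \<longleftrightarrow> (\<exists>E x y. nfs_params E x y \<and> nfs_pair E x y \<subseteq> F \<and>
    nfs_flip E x y \<inter> F = {} \<and> G = (F - nfs_pair E x y) \<union> nfs_flip E x y)"

definition nfs_irreducible :: "int set set \<Rightarrow> bool" where
  "nfs_irreducible F \<longleftrightarrow> unsat_hitting F \<and> clause_irreducible F \<and>
    \<not> (\<exists>G. nfs_step\<^sup>*\<^sup>* F G \<and> clause_reducible G)"

end

theory Submission
  imports Defs
begin

text \<open>
  Call a literal unique if it occurs in exactly one clause; for unsatisfiable hitting clause-sets,
  nonsingular means that there is no unique literal. Eliminating a unique literal keeps the deficiency
  and lowers both the number of variables and (since a clause contains at most one unique literal)
  the number of unique literals. So a bound \<open>B\<close> on the number of variables in the nonsingular case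
  becomes \<open>B\<close> plus the number of unique literals in general.

  A nontrivial clause-factor of \<open>F\<close> splits \<open>F\<close> into a quotient and a residue, sharing \<open>s\<close> variables,
  whose deficiencies add up to \<open>\<delta>(F) + 1 - s\<close>. If \<open>F\<close> is nonsingular then all unique literals of
  these parts are over shared variables, except for at most one in the quotient. Both parts then have
  smaller deficiency, and \<open>4k - 5\<close> propagates with a slack of \<open>s\<close>.

  If a flip turns a clause-irreducible (hence nonsingular) clause-set into a clause-reducible one,
  then at most one variable becomes singular, and eliminating it yields a nonsingular clause-set
  with a pair \<open>E \<union> {y}\<close>, \<open>E \<union> {- y}\<close>. For this factor \<open>s \<ge> 1\<close>, and the slack pays for the eliminated
  variable. It remains to treat deficiency 2 directly, and to realise \<open>4k - 5\<close>: join two clause-sets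
  on disjoint variables by adding \<open>v\<close> to the clauses of one and \<open>- v\<close> to those of the other.
\<close>

subsection \<open>Unsatisfiable hitting clause-sets as partitions\<close>

text \<open>A total assignment is represented by the set of literals it falsifies, so that a clause is
  falsified iff it is a subset.\<close>

definition total_lits :: "int set \<Rightarrow> bool" where
  "total_lits T \<longleftrightarrow> (\<forall>x. x \<noteq> 0 \<longrightarrow> (- x \<in> T \<longleftrightarrow> x \<notin> T))"

lemma total_lits_consistent: "total_lits T \<Longrightarrow> x \<in> T \<Longrightarrow> - x \<in> T \<Longrightarrow> x = 0"
  unfolding total_lits_def by blast

text \<open>As \<open>T\<close> lists the falsified literals, this is the assignment that makes
  \<open>x\<close> false and agrees with \<open>T\<close> on all other variables.\<close>

definition force :: "int \<Rightarrow> int set \<Rightarrow> int set" where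
  "force x T = insert x (T - {- x})"

lemma total_force: "total_lits T \<Longrightarrow> x \<noteq> 0 \<Longrightarrow> total_lits (force x T)"
  unfolding total_lits_def force_def by auto

lemma mem_force [simp]: "y \<in> force x T \<longleftrightarrow> y = x \<or> y \<in> T \<and> y \<noteq> - x"
  by (auto simp: force_def)

lemma clause_literal: "clause C \<Longrightarrow> x \<in> C \<Longrightarrow> x \<noteq> 0 \<and> - x \<notin> C \<and> x \<noteq> - x"
  unfolding clause_def by auto

lemma clause_subset: "clause C \<Longrightarrow> D \<subseteq> C \<Longrightarrow> clause D"
  unfolding clause_def by (auto intro: finite_subset)

lemma clause_insert: "clause C \<Longrightarrow> x \<noteq> 0 \<Longrightarrow> - x \<notin> C \<Longrightarrow> clause (insert x C)"
  unfolding clause_def by auto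

lemma total_extension:
  assumes "clause C"
  obtains T where "total_lits T" "C \<subseteq> T"
proof
  show "total_lits {x. x \<in> C \<or> x > 0 \<and> - x \<notin> C}"
    using assms unfolding total_lits_def clause_def by (auto simp: neg_less_0_iff_less)
qed auto

lemma total_override:
  assumes "clause C" "total_lits T"
  shows "total_lits (C \<union> (T - uminus ` C))"
proof -
  have m: "x \<in> uminus ` C \<longleftrightarrow> - x \<in> C" for x by (metis image_iff minus_minus)
  show ?thesis using assms unfolding total_lits_def clause_def by (auto simp: m)
qed

text \<open>If \<open>x\<close> in \<open>D\<close> were not in \<open>C\<close>, then adding
  \<open>- x\<close> to \<open>C\<close> would still give a clause, so some assignment would falsify
  \<open>C\<close> while making \<open>x\<close> true.\<close>

lemma subset_if_implied:
  assumes "clause C" "0 \<notin> D" "\<And>T. total_lits T \<Longrightarrow> C \<subseteq> T \<Longrightarrow> D \<subseteq> T"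
  shows "D \<subseteq> C"
proof
  fix x assume x: "x \<in> D"
  show "x \<in> C"
  proof (rule ccontr)
    assume nx: "x \<notin> C"
    have "x \<noteq> 0" using x assms(2) by metis
    then have "clause (insert (- x) C)" using nx assms(1) by (simp add: clause_insert)
    then obtain T where T: "total_lits T" "insert (- x) C \<subseteq> T" by (rule total_extension)
    then have "x \<in> T" using assms(3) x by blast
    then show False using T \<open>x \<noteq> 0\<close> total_lits_consistent by blast
  qed
qed

lemma unsat_iff_total:
  assumes "clause_set F"
  shows "\<not> satisfiable F \<longleftrightarrow> (\<forall>T. total_lits T \<longrightarrow> (\<exists>C\<in>F. C \<subseteq> T))"
proof
  assume u: "\<not> satisfiable F"
  show "\<forall>T. total_lits T \<longrightarrow> (\<exists>C\<in>F. C \<subseteq> T)"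
  proof (intro allI impI, rule ccontr)
    fix T assume T: "total_lits T" and n: "\<not> (\<exists>C\<in>F. C \<subseteq> T)"
    have fin: "finite (\<Union>F)" using assms unfolding clause_set_def clause_def by auto
    have z: "0 \<notin> \<Union>F" using assms unfolding clause_set_def clause_def by auto
    \<comment> \<open>These are the literals of \<open>F\<close> that \<open>T\<close> makes true;
      they meet every clause that \<open>T\<close> does not falsify.\<close>
    have "clause (\<Union>F - T)"
      unfolding clause_def using fin z T unfolding total_lits_def by (auto, metis)
    moreover have "\<forall>D\<in>F. (\<Union>F - T) \<inter> D \<noteq> {}" using n by blast
    ultimately show False using u unfolding satisfiable_def by blast
  qed
next
  assume h: "\<forall>T. total_lits T \<longrightarrow> (\<exists>C\<in>F. C \<subseteq> T)"
  show "\<not> satisfiable F"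
  proof
    assume "satisfiable F"
    then obtain C where C: "clause C" "\<forall>D\<in>F. C \<inter> D \<noteq> {}" unfolding satisfiable_def by blast
    have "clause (uminus ` C)" using C(1) unfolding clause_def by auto
    then obtain T where T: "total_lits T" "uminus ` C \<subseteq> T" by (rule total_extension)
    then obtain D where D: "D \<in> F" "D \<subseteq> T" using h by blast
    then obtain x where x: "x \<in> C" "x \<in> D" using C by blast
    then have "x \<in> T" "- x \<in> T" using T D by auto
    then show False using total_lits_consistent[OF T(1)] x(1) C(1) clause_literal by blast
  qed
qed

text \<open>Unsatisfiability says that the sets of assignments falsifying the clauses cover
  everything. Hitting says that they are disjoint, since the union of two clauses without a clash is
  itself a clause and is falsified by some assignment.\<close>

lemma unsat_hitting_iff_partition:
  "unsat_hitting F \<longleftrightarrow> clause_set F \<and> (\<forall>T. total_lits T \<longrightarrow> (\<exists>!C. C \<in> F \<and> C \<subseteq> T))"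
proof
  assume F: "unsat_hitting F"
  then have cs: "clause_set F" and h: "hitting F" unfolding unsat_hitting_def by auto
  have ex: "\<exists>C\<in>F. C \<subseteq> T" if "total_lits T" for T
    using F that unsat_iff_total unfolding unsat_hitting_def by blast
  have "C = D" if "total_lits T" "C \<in> F" "D \<in> F" "C \<subseteq> T" "D \<subseteq> T" for C D T
  proof (rule ccontr)
    assume "C \<noteq> D"
    with h that(2,3) have "\<exists>x\<in>C. - x \<in> D" unfolding hitting_def by metis
    then obtain x where x: "x \<in> C" "- x \<in> D" ..
    moreover have "x \<noteq> 0" using x cs that unfolding clause_set_def clause_def by metis
    ultimately show False using total_lits_consistent[OF that(1), of x] that(4,5) by blast
  qed
  with ex cs show "clause_set F \<and> (\<forall>T. total_lits T \<longrightarrow> (\<exists>!C. C \<in> F \<and> C \<subseteq> T))" by blast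
next
  assume h: "clause_set F \<and> (\<forall>T. total_lits T \<longrightarrow> (\<exists>!C. C \<in> F \<and> C \<subseteq> T))"
  then have cs: "clause_set F" and ex: "\<forall>T. total_lits T \<longrightarrow> (\<exists>C\<in>F. C \<subseteq> T)"
    and un: "\<And>T C D. total_lits T \<Longrightarrow> C \<in> F \<Longrightarrow> D \<in> F \<Longrightarrow> C \<subseteq> T \<Longrightarrow> D \<subseteq> T \<Longrightarrow> C = D"
    by metis+
  have "\<not> satisfiable F" using ex unsat_iff_total[OF cs] by simp
  moreover have "hitting F" unfolding hitting_def
  proof (intro ballI impI, rule ccontr)
    fix C D assume CD: "C \<in> F" "D \<in> F" "C \<noteq> D" and n: "\<not> (\<exists>x\<in>C. - x \<in> D)"
    have "clause C" "clause D" using cs CD unfolding clause_set_def by auto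
    then have "clause (C \<union> D)" using n unfolding clause_def by auto
    then obtain T where "total_lits T" "C \<union> D \<subseteq> T" by (rule total_extension)
    then show False using un[of T C D] CD by simp
  qed
  ultimately show "unsat_hitting F" using cs unfolding unsat_hitting_def by blast
qed

lemma uh_clause: "unsat_hitting F \<Longrightarrow> C \<in> F \<Longrightarrow> clause C"
  unfolding unsat_hitting_def clause_set_def by blast

lemma uh_finite: "unsat_hitting F \<Longrightarrow> finite F"
  unfolding unsat_hitting_def clause_set_def by blast

lemma uh_literal: "unsat_hitting F \<Longrightarrow> C \<in> F \<Longrightarrow> x \<in> C \<Longrightarrow> x \<noteq> 0 \<and> - x \<notin> C \<and> x \<noteq> - x"
  using uh_clause clause_literal by blast

lemma uh_ex:
  assumes "unsat_hitting F" "total_lits T"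
  obtains C where "C \<in> F" "C \<subseteq> T"
  using assms unfolding unsat_hitting_iff_partition by metis

lemma uh_unique:
  "unsat_hitting F \<Longrightarrow> total_lits T \<Longrightarrow> C \<in> F \<Longrightarrow> D \<in> F \<Longrightarrow> C \<subseteq> T \<Longrightarrow> D \<subseteq> T \<Longrightarrow> C = D"
  unfolding unsat_hitting_iff_partition by metis

lemma uh_subset_eq:
  assumes "unsat_hitting F" "C \<in> F" "D \<in> F" "C \<subseteq> D"
  shows "C = D"
proof -
  obtain T where "total_lits T" "D \<subseteq> T" using total_extension uh_clause assms by metis
  then show ?thesis using uh_unique assms by blast
qed

text \<open>Once \<open>x\<close> is made true, \<open>H\<close> is no longer falsified, so another
  clause is. That clause contains \<open>- x\<close>, as otherwise \<open>T\<close> would already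
  falsify it besides \<open>H\<close>.\<close>

lemma uh_flip:
  assumes F: "unsat_hitting F" and H: "H \<in> F" "x \<in> H" and T: "total_lits T" "H \<subseteq> T"
  obtains D where "D \<in> F" "- x \<in> D" "D \<subseteq> force (- x) T"
proof -
  have x0: "x \<noteq> 0" using uh_literal F H by blast
  then obtain D where D: "D \<in> F" "D \<subseteq> force (- x) T"
    using uh_ex[OF F] total_force T by (metis neg_equal_0_iff_equal)
  have "- x \<in> D"
  proof (rule ccontr)
    assume "- x \<notin> D"
    then have "D \<subseteq> T" using D by auto
    then have "D = H" using uh_unique F D H T by blast
    then have "x \<in> force (- x) T" using D H by blast
    then show False using x0 by auto
  qed
  then show ?thesis using that D by blast
qed

lemma uh_complement_occurs:
  assumes F: "unsat_hitting F" and H: "H \<in> F" "x \<in> H"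
  obtains D where "D \<in> F" "- x \<in> D"
proof -
  obtain T where "total_lits T" "H \<subseteq> T" using total_extension uh_clause assms by metis
  then show ?thesis using uh_flip F H that by metis
qed

lemma uh_complement_literal: "unsat_hitting F \<Longrightarrow> x \<in> \<Union>F \<Longrightarrow> - x \<in> \<Union>F"
  by (metis UnionE UnionI uh_complement_occurs)

lemma mem_vars_iff:
  assumes "unsat_hitting F"
  shows "v \<in> vars F \<longleftrightarrow> v > 0 \<and> v \<in> \<Union>F"
proof
  assume "v \<in> vars F"
  then obtain x where x: "x \<in> \<Union>F" "v = \<bar>x\<bar>" unfolding vars_def by auto
  then have "x \<noteq> 0" using uh_literal assms by blast
  moreover have "\<bar>x\<bar> \<in> \<Union>F" using uh_complement_literal[OF assms x(1)] x(1) by (simp add: abs_if)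
  ultimately show "v > 0 \<and> v \<in> \<Union>F" using x by auto
next
  assume "v > 0 \<and> v \<in> \<Union>F"
  then show "v \<in> vars F" unfolding vars_def by (metis abs_of_pos image_eqI)
qed

lemma abs_mem_vars_iff:
  assumes "unsat_hitting F"
  shows "\<bar>x\<bar> \<in> vars F \<longleftrightarrow> x \<in> \<Union>F"
  unfolding mem_vars_iff[OF assms]
  by (smt (verit) UnionE assms minus_minus uh_literal uh_complement_literal)

lemma finite_lits: "unsat_hitting F \<Longrightarrow> finite (\<Union>F)"
  unfolding unsat_hitting_def clause_set_def clause_def by auto

lemma finite_vars: "unsat_hitting F \<Longrightarrow> finite (vars F)"
  unfolding vars_def by (simp add: finite_lits)

lemma ldeg_pos: "unsat_hitting F \<Longrightarrow> x \<in> \<Union>F \<Longrightarrow> ldeg F x \<ge> 1"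
  unfolding ldeg_def by (auto simp: Suc_le_eq card_gt_0_iff uh_finite)

lemma ldeg_eq_1I:
  "C \<in> F \<Longrightarrow> x \<in> C \<Longrightarrow> (\<And>D. D \<in> F \<Longrightarrow> x \<in> D \<Longrightarrow> D = C) \<Longrightarrow> ldeg F x = 1"
  unfolding ldeg_def One_nat_def card_1_singleton_iff by (rule exI[of _ C]) blast

section \<open>Literals with a single occurrence\<close>

definition unique_lits :: "int set set \<Rightarrow> int set" where
  "unique_lits F = {x. ldeg F x = 1}"

lemma unique_lits_obtain:
  assumes "x \<in> unique_lits F"
  obtains H where "H \<in> F" "x \<in> H" "\<And>D. D \<in> F \<Longrightarrow> x \<in> D \<Longrightarrow> D = H"
proof -
  from assms have "card {C \<in> F. x \<in> C} = Suc 0" unfolding unique_lits_def ldeg_def by simp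
  then obtain H where "{C \<in> F. x \<in> C} = {H}" unfolding card_1_singleton_iff by blast
  then show ?thesis using that by blast
qed

lemma unique_lits_iff: "x \<in> unique_lits F \<longleftrightarrow> (\<exists>H\<in>F. x \<in> H \<and> (\<forall>D\<in>F. x \<in> D \<longrightarrow> D = H))"
proof
  assume "x \<in> unique_lits F"
  then show "\<exists>H\<in>F. x \<in> H \<and> (\<forall>D\<in>F. x \<in> D \<longrightarrow> D = H)" by (rule unique_lits_obtain) blast
qed (auto simp: unique_lits_def intro: ldeg_eq_1I[simplified])

lemma finite_unique_lits: "unsat_hitting F \<Longrightarrow> finite (unique_lits F)"
  using finite_lits finite_subset[of "unique_lits F" "\<Union>F"] unique_lits_iff by blast

text \<open>The complement of an occurring literal occurs too, so a unique literal makes the minimum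
  of both degrees exactly 1.\<close>

lemma nonsingular_iff:
  assumes F: "unsat_hitting F"
  shows "nonsingular F \<longleftrightarrow> unique_lits F = {}"
proof
  assume n: "nonsingular F"
  show "unique_lits F = {}"
  proof (rule ccontr)
    assume "unique_lits F \<noteq> {}"
    then obtain x where x: "x \<in> unique_lits F" by blast
    then have xF: "x \<in> \<Union>F" unfolding unique_lits_iff by blast
    then have "- x \<in> \<Union>F" using uh_complement_literal F by blast
    then have "ldeg F (- x) \<ge> 1" "ldeg F x = 1" using ldeg_pos F x unfolding unique_lits_def by auto
    then have "singular_var F \<bar>x\<bar>"
      unfolding singular_var_def using abs_mem_vars_iff[OF F] xF by (auto simp: abs_if)
    then show False using n unfolding nonsingular_def by blast
  qed
next
  assume "unique_lits F = {}"
  then show "nonsingular F"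
    unfolding nonsingular_def singular_var_def unique_lits_def by (auto simp: min_def)
qed

text \<open>Take any assignment falsifying \<open>D\<close> and make \<open>x\<close> false. By
  \<open>uh_flip\<close> the clause now falsified contains \<open>x\<close>, hence is
  \<open>H\<close>; so \<open>H - {x}\<close> was already falsified.\<close>

lemma unique_lit_subset:
  assumes F: "unsat_hitting F" and x: "x \<in> unique_lits F"
    and H: "H \<in> F" "x \<in> H" and D: "D \<in> F" "- x \<in> D"
  shows "H - {x} \<subseteq> D"
proof (rule subset_if_implied)
  show "clause D" using uh_clause F D by blast
  show "0 \<notin> H - {x}" using uh_literal[OF F H(1)] by blast
  fix T assume T: "total_lits T" "D \<subseteq> T"
  obtain E where E: "E \<in> F" "x \<in> E" "E \<subseteq> force x T"
    using uh_flip[OF F D T] by auto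
  then have "E = H" using x H unique_lits_iff by blast
  then show "H - {x} \<subseteq> T" using E by auto
qed

text \<open>A second unique literal of \<open>H\<close> would, by \<open>unique_lit_subset\<close>,
  also lie in a clause containing \<open>- x\<close>, which differs from \<open>H\<close>.\<close>

lemma unique_lits_clause_eq:
  assumes F: "unsat_hitting F" and x: "x \<in> unique_lits F" and y: "y \<in> unique_lits F"
    and H: "H \<in> F" "x \<in> H" "y \<in> H"
  shows "x = y"
proof (rule ccontr)
  assume "x \<noteq> y"
  obtain D where D: "D \<in> F" "- x \<in> D" using uh_complement_occurs F H by metis
  then have "y \<in> D" using unique_lit_subset[OF F x H(1,2) D] H \<open>x \<noteq> y\<close> by blast
  then have "D = H" using y D H unique_lits_iff by metis
  then show False using D H uh_literal F by blast
qed

subsection \<open>Restriction and unique literals\<close>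

text \<open>Setting the literal \<open>x\<close> to true. If \<open>x\<close> occurs only once this coincides with the
  (singular) Davis-Putnam elimination of its variable.\<close>

definition restrict_lit :: "int set set \<Rightarrow> int \<Rightarrow> int set set" where
  "restrict_lit F x = (\<lambda>D. D - {- x}) ` {D \<in> F. x \<notin> D}"

text \<open>Two clauses that differ at most in \<open>- x\<close> are both falsified by an
  assignment that falsifies one of them and \<open>- x\<close>.\<close>

lemma inj_restrict:
  assumes F: "unsat_hitting F" and x0: "x \<noteq> 0"
  shows "inj_on (\<lambda>D. D - {- x}) {D \<in> F. x \<notin> D}"
proof (rule inj_onI)
  fix C D assume C: "C \<in> {D \<in> F. x \<notin> D}" and D: "D \<in> {D \<in> F. x \<notin> D}"
    and e: "C - {- x} = D - {- x}"
  have "clause (insert (- x) C)"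
    using C uh_clause[OF F] x0 by (auto intro!: clause_insert)
  then obtain T where T: "total_lits T" "insert (- x) C \<subseteq> T" by (rule total_extension)
  then have "D \<subseteq> T" using e by blast
  then show "C = D" using uh_unique[OF F T(1)] C D T by blast
qed

text \<open>A restricted clause is falsified by \<open>T\<close> iff its original is falsified by
  \<open>T\<close> with \<open>x\<close> made true.\<close>

lemma restrict_unsat_hitting:
  assumes F: "unsat_hitting F" and x0: "x \<noteq> 0"
  shows "unsat_hitting (restrict_lit F x)"
  unfolding unsat_hitting_iff_partition
proof (intro conjI allI impI)
  show "clause_set (restrict_lit F x)"
    using F unfolding unsat_hitting_def clause_set_def restrict_lit_def
    by (auto intro: clause_subset)
  fix T assume T: "total_lits T"
  have T': "total_lits (force (- x) T)" using T x0 by (simp add: total_force)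
  then obtain D where D: "D \<in> F" "D \<subseteq> force (- x) T" using uh_ex[OF F] by blast
  have "x \<notin> D" using D x0 by auto
  show "\<exists>!C. C \<in> restrict_lit F x \<and> C \<subseteq> T"
  proof (rule ex1I)
    show "D - {- x} \<in> restrict_lit F x \<and> D - {- x} \<subseteq> T"
      using D \<open>x \<notin> D\<close> unfolding restrict_lit_def by auto
    fix C assume "C \<in> restrict_lit F x \<and> C \<subseteq> T"
    then obtain C' where C': "C' \<in> F" "x \<notin> C'" "C = C' - {- x}" "C' - {- x} \<subseteq> T"
      unfolding restrict_lit_def by auto
    then have "C' \<subseteq> force (- x) T" by auto
    then show "C = D - {- x}" using uh_unique[OF F T'] C' D by blast
  qed
qed

lemma card_restrict:
  assumes F: "unsat_hitting F" and x0: "x \<noteq> 0"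
  shows "card (restrict_lit F x) + ldeg F x = card F"
proof -
  have "card (restrict_lit F x) = card {D \<in> F. x \<notin> D}"
    unfolding restrict_lit_def using card_image inj_restrict[OF F x0] by blast
  moreover have "F = {D \<in> F. x \<notin> D} \<union> {D \<in> F. x \<in> D}" by blast
  then have "card F = card {D \<in> F. x \<notin> D} + card {D \<in> F. x \<in> D}"
    using card_Un_disjoint[of "{D \<in> F. x \<notin> D}" "{D \<in> F. x \<in> D}"] uh_finite[OF F] by auto
  ultimately show ?thesis unfolding ldeg_def by simp
qed

lemma vars_restrict_subset: "vars (restrict_lit F x) \<subseteq> vars F - {\<bar>x\<bar>}"
  unfolding restrict_lit_def vars_def by (auto simp: abs_if split: if_splits)

section \<open>Positivity of the deficiency and literals of low degree\<close>

lemma nvars_0_iff: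
  assumes F: "unsat_hitting F"
  shows "nvars F = 0 \<longleftrightarrow> F = {{}}"
proof
  assume "nvars F = 0"
  then have "\<Union>F = {}" unfolding nvars_def using finite_vars[OF F] by (auto simp: vars_def)
  then have "F \<subseteq> {{}}" by auto
  moreover have "F \<noteq> {}" using F unfolding unsat_hitting_def satisfiable_def clause_def by auto
  ultimately show "F = {{}}" by auto
qed (auto simp: nvars_def vars_def)

lemma min_degree_literal:
  assumes F: "unsat_hitting F" and n: "nvars F > 0"
  obtains x where "x \<in> \<Union>F" "vars (restrict_lit F x) = vars F - {\<bar>x\<bar>}"
proof -
  have "\<Union>F \<noteq> {}"
  proof
    assume "\<Union>F = {}"
    then have "vars F = {}" unfolding vars_def by (simp only: image_empty)
    then show False using n unfolding nvars_def by simp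
  qed
  then obtain x where x: "x \<in> \<Union>F" "\<And>y. y \<in> \<Union>F \<Longrightarrow> ldeg F x \<le> ldeg F y"
    using finite_lits[OF F] arg_min_if_finite(1) arg_min_least by metis
  have "vars F - {\<bar>x\<bar>} \<subseteq> vars (restrict_lit F x)"
  proof
    fix u assume u: "u \<in> vars F - {\<bar>x\<bar>}"
    then have u': "u > 0" "u \<in> \<Union>F" "- u \<in> \<Union>F" using mem_vars_iff[OF F] uh_complement_literal[OF F] by auto
    show "u \<in> vars (restrict_lit F x)"
    proof (rule ccontr)
      assume nu: "u \<notin> vars (restrict_lit F x)"
      \<comment> \<open>A variable lost by the restriction occurs only together with \<open>x\<close>, so its two literals
        have smaller degree than \<open>x\<close>.\<close>
      have *: "x \<in> D" if "D \<in> F" "y \<in> D" "\<bar>y\<bar> = u" for y D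
      proof (rule ccontr)
        assume "x \<notin> D"
        then have "D - {- x} \<in> restrict_lit F x" using that unfolding restrict_lit_def by blast
        moreover have "y \<in> D - {- x}" using that u by auto
        ultimately have "\<bar>y\<bar> \<in> vars (restrict_lit F x)" unfolding vars_def by blast
        then show False using nu that by simp
      qed
      obtain D where D: "D \<in> F" "- u \<in> D" using u' by blast
      have "x \<in> D" using *[OF D] u' by simp
      have "u \<notin> D" using D uh_literal[OF F] by fastforce
      have "{D \<in> F. u \<in> D} \<subset> {D \<in> F. x \<in> D}"
        using * u' D \<open>x \<in> D\<close> \<open>u \<notin> D\<close> by auto
      then have "ldeg F u < ldeg F x" unfolding ldeg_def by (simp add: psubset_card_mono uh_finite[OF F])
      then show False using x(2)[of u] u' by simp
    qed
  qed
  then show ?thesis using that x vars_restrict_subset[of F x] by blast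
qed

lemma nvars_restrict:
  assumes F: "unsat_hitting F" and x: "x \<in> \<Union>F" and v: "vars (restrict_lit F x) = vars F - {\<bar>x\<bar>}"
  shows "nvars F = Suc (nvars (restrict_lit F x))"
proof -
  have "\<bar>x\<bar> \<in> vars F" using x abs_mem_vars_iff[OF F] by blast
  then show ?thesis unfolding nvars_def v using finite_vars[OF F]
    by (metis card.remove)
qed

lemma deficiency_restrict:
  assumes F: "unsat_hitting F" and x: "x \<in> \<Union>F" and v: "vars (restrict_lit F x) = vars F - {\<bar>x\<bar>}"
  shows "deficiency F = deficiency (restrict_lit F x) + int (ldeg F x) - 1"
proof -
  have "x \<noteq> 0" using x uh_literal[OF F] by blast
  then show ?thesis
    using nvars_restrict[OF F x v] card_restrict[OF F, of x] unfolding deficiency_def by simp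
qed

text \<open>Restricting to a literal of minimum degree removes one variable and at least one clause,
  so the deficiency does not grow; the induction ends at \<open>{{}}\<close>.\<close>

lemma deficiency_pos:
  assumes "unsat_hitting F"
  shows "deficiency F \<ge> 1"
  using assms
proof (induction "nvars F" arbitrary: F)
  case 0
  then have "F = {{}}" using nvars_0_iff by metis
  then show ?case using 0 by (simp add: deficiency_def)
next
  case (Suc n)
  obtain x where x: "x \<in> \<Union>F" "vars (restrict_lit F x) = vars F - {\<bar>x\<bar>}"
    using min_degree_literal Suc by (metis zero_less_Suc)
  have "x \<noteq> 0" using x uh_literal[OF Suc.prems] by blast
  then have "deficiency (restrict_lit F x) \<ge> 1"
    using Suc nvars_restrict[OF Suc.prems x] restrict_unsat_hitting[OF Suc.prems] by simp
  then show ?case using deficiency_restrict[OF Suc.prems x] ldeg_pos[OF Suc.prems x(1)] by simp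
qed

text \<open>The restriction still has deficiency at least 1, which bounds the number of removed
  clauses.\<close>

lemma low_degree_literal:
  assumes F: "unsat_hitting F" and n: "nvars F > 0"
  obtains x where "x \<in> \<Union>F" "int (ldeg F x) \<le> deficiency F"
    "vars (restrict_lit F x) = vars F - {\<bar>x\<bar>}"
proof -
  obtain x where x: "x \<in> \<Union>F" "vars (restrict_lit F x) = vars F - {\<bar>x\<bar>}"
    using min_degree_literal[OF F n] .
  have "x \<noteq> 0" using x uh_literal[OF F] by blast
  then have "deficiency (restrict_lit F x) \<ge> 1"
    using restrict_unsat_hitting[OF F] deficiency_pos by blast
  then show ?thesis using that x deficiency_restrict[OF F x] by simp
qed

lemma deficiency_1_singular:
  assumes F: "unsat_hitting F" and n: "nvars F > 0" and d: "deficiency F = 1"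
  shows "unique_lits F \<noteq> {}"
proof -
  obtain x where x: "x \<in> \<Union>F" "int (ldeg F x) \<le> deficiency F"
    using low_degree_literal[OF F n] by metis
  then have "ldeg F x = 1" using d ldeg_pos[OF F, of x] by linarith
  then show ?thesis unfolding unique_lits_def by blast
qed

section \<open>Eliminating unique literals\<close>

lemma vars_restrict_unique:
  assumes F: "unsat_hitting F" and x: "x \<in> unique_lits F"
  shows "vars (restrict_lit F x) = vars F - {\<bar>x\<bar>}"
proof
  obtain H where H: "H \<in> F" "x \<in> H" "\<And>D. D \<in> F \<Longrightarrow> x \<in> D \<Longrightarrow> D = H"
    using unique_lits_obtain[OF x] by blast
  have x0: "x \<noteq> 0" "x \<noteq> - x" using uh_literal[OF F H(1,2)] by auto
  show "vars (restrict_lit F x) \<subseteq> vars F - {\<bar>x\<bar>}" using vars_restrict_subset .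
  obtain D where D: "D \<in> F" "- x \<in> D" using uh_complement_occurs[OF F H(1,2)] by blast
  \<comment> \<open>\<open>H\<close> is the only clause that disappears, and its other literals
    survive in \<open>D\<close>; so no variable except that of \<open>x\<close> is lost.\<close>
  have HD: "H - {x} \<subseteq> D" using unique_lit_subset[OF F x H(1,2) D] .
  have "x \<notin> D" using D uh_literal[OF F D] by auto
  show "vars F - {\<bar>x\<bar>} \<subseteq> vars (restrict_lit F x)"
  proof
    fix u assume u: "u \<in> vars F - {\<bar>x\<bar>}"
    then obtain E y where E: "E \<in> F" "y \<in> E" "u = \<bar>y\<bar>" unfolding vars_def by auto
    have "\<exists>E'\<in>F. y \<in> E' \<and> x \<notin> E'"
    proof (cases "x \<in> E")
      case True
      then have "y \<in> D" using E H(3) HD u by auto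
      then show ?thesis using D \<open>x \<notin> D\<close> by blast
    qed (use E in blast)
    then obtain E' where "E' \<in> F" "y \<in> E'" "x \<notin> E'" by blast
    moreover have "y \<noteq> - x" using E u by auto
    ultimately show "u \<in> vars (restrict_lit F x)"
      unfolding vars_def restrict_lit_def E(3) by blast
  qed
qed

lemma nvars_restrict_unique:
  assumes F: "unsat_hitting F" and x: "x \<in> unique_lits F"
  shows "nvars F = Suc (nvars (restrict_lit F x))"
  using nvars_restrict[OF F _ vars_restrict_unique[OF F x]] x unfolding unique_lits_iff by blast

lemma deficiency_restrict_unique:
  assumes F: "unsat_hitting F" and x: "x \<in> unique_lits F"
  shows "deficiency (restrict_lit F x) = deficiency F"
proof -
  have "x \<in> \<Union>F" using x unfolding unique_lits_iff by blast
  moreover have "ldeg F x = 1" using x unfolding unique_lits_def by simp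
  ultimately show ?thesis using deficiency_restrict[OF F _ vars_restrict_unique[OF F x]] by simp
qed

text \<open>Only clauses containing \<open>x\<close> disappear, so a literal can newly become unique
  only if it occurs in one of them.\<close>

lemma restrict_unique_lits_cases:
  assumes F: "unsat_hitting F" and x0: "x \<noteq> 0" and y: "y \<in> unique_lits (restrict_lit F x)"
  shows "y \<noteq> x \<and> y \<noteq> - x \<and> (y \<in> unique_lits F \<or> (\<exists>H\<in>F. x \<in> H \<and> y \<in> H))"
proof -
  obtain E where E: "E \<in> restrict_lit F x" "y \<in> E"
    "\<And>D. D \<in> restrict_lit F x \<Longrightarrow> y \<in> D \<Longrightarrow> D = E"
    using unique_lits_obtain[OF y] by blast
  then obtain E' where E': "E' \<in> F" "x \<notin> E'" "E = E' - {- x}" unfolding restrict_lit_def by blast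
  have ne: "y \<noteq> x \<and> y \<noteq> - x" using E(2) E'(2,3) by auto
  have "y \<in> unique_lits F" if n: "\<not> (\<exists>H\<in>F. x \<in> H \<and> y \<in> H)"
    unfolding unique_lits_iff
  proof (intro bexI conjI ballI impI)
    show "E' \<in> F" "y \<in> E'" using E' E(2) by auto
    fix D assume D: "D \<in> F" "y \<in> D"
    then have "x \<notin> D" using n by blast
    then have "D - {- x} \<in> restrict_lit F x" "y \<in> D - {- x}"
      using D ne unfolding restrict_lit_def by auto
    then have "D - {- x} = E' - {- x}" using E(3) E'(3) by blast
    then show "D = E'" using inj_onD[OF inj_restrict[OF F x0]] D \<open>x \<notin> D\<close> E' by auto
  qed
  then show ?thesis using ne by blast
qed

text \<open>The other literals of the removed clause \<open>H\<close> lie in every clause containing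
  \<open>- x\<close>. If there are at least two of these, no literal of \<open>H\<close> becomes
  unique.\<close>

lemma restrict_unique_lits_subset:
  assumes F: "unsat_hitting F" and x: "x \<in> unique_lits F" and deg: "- x \<notin> unique_lits F"
  shows "unique_lits (restrict_lit F x) \<subseteq> unique_lits F - {x}"
proof
  fix y assume y: "y \<in> unique_lits (restrict_lit F x)"
  obtain H where H: "H \<in> F" "x \<in> H" "\<And>D. D \<in> F \<Longrightarrow> x \<in> D \<Longrightarrow> D = H"
    using unique_lits_obtain[OF x] by blast
  have x0: "x \<noteq> 0" using uh_literal[OF F H(1,2)] by auto
  have c: "y \<noteq> x" "y \<noteq> - x" "y \<in> unique_lits F \<or> y \<in> H"
    using restrict_unique_lits_cases[OF F x0 y] H(3) by auto
  have "y \<notin> H"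
  proof
    assume yH: "y \<in> H"
    obtain D where D: "D \<in> F" "- x \<in> D" using uh_complement_occurs[OF F H(1,2)] by blast
    then obtain D' where D': "D' \<in> F" "- x \<in> D'" "D' \<noteq> D" using deg unfolding unique_lits_iff by blast
    have "y \<in> D" "y \<in> D'" using unique_lit_subset[OF F x H(1,2)] D D' yH c by blast+
    moreover have "x \<notin> D" "x \<notin> D'" using uh_literal[OF F D] uh_literal[OF F D'(1,2)] by auto
    ultimately have "y \<in> D - {- x}" "y \<in> D' - {- x}" "D - {- x} \<in> restrict_lit F x"
      "D' - {- x} \<in> restrict_lit F x"
      using c D D' unfolding restrict_lit_def by auto
    then have "D - {- x} = D' - {- x}" using y unfolding unique_lits_iff by metis
    then show False using D D' by blast
  qed
  then show "y \<in> unique_lits F - {x}" using c by blast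
qed

text \<open>If \<open>- x\<close> is unique as well, two unique literals vanish. The ones that may
  arise from \<open>H\<close> all lie in the clause \<open>D - {- x}\<close>, which contains at most
  one unique literal.\<close>

lemma card_unique_lits_restrict:
  assumes F: "unsat_hitting F" and x: "x \<in> unique_lits F"
  shows "card (unique_lits (restrict_lit F x)) < card (unique_lits F)"
proof (cases "- x \<in> unique_lits F")
  case False
  then have "unique_lits (restrict_lit F x) \<subset> unique_lits F"
    using restrict_unique_lits_subset[OF F x] x by blast
  then show ?thesis by (simp add: psubset_card_mono finite_unique_lits[OF F])
next
  case True
  obtain H where H: "H \<in> F" "x \<in> H" "\<And>D. D \<in> F \<Longrightarrow> x \<in> D \<Longrightarrow> D = H"
    using unique_lits_obtain[OF x] by blast
  have x0: "x \<noteq> 0" "x \<noteq> - x" using uh_literal[OF F H(1,2)] by auto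
  let ?R = "restrict_lit F x"
  have R: "unsat_hitting ?R" using restrict_unsat_hitting[OF F x0(1)] .
  let ?S = "unique_lits ?R \<inter> H"
  obtain D where D: "D \<in> F" "- x \<in> D" using uh_complement_occurs[OF F H(1,2)] by blast
  have HD: "H - {x} \<subseteq> D" using unique_lit_subset[OF F x H(1,2) D] .
  have "x \<notin> D" using D uh_literal[OF F D] by auto
  then have DR: "D - {- x} \<in> ?R" using D unfolding restrict_lit_def by blast
  have cases: "y \<noteq> x \<and> y \<noteq> - x \<and> (y \<in> unique_lits F \<or> y \<in> H)" if "y \<in> unique_lits ?R" for y
    using restrict_unique_lits_cases[OF F x0(1) that] H(3) by auto
  have "a = b" if "a \<in> ?S" "b \<in> ?S" for a b
  proof -
    have "a \<in> D - {- x}" "b \<in> D - {- x}" using that cases HD by auto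
    then show ?thesis using unique_lits_clause_eq[OF R _ _ DR] that by blast
  qed
  then have S: "card ?S \<le> 1"
    by (metis card_le_Suc0_iff_eq finite_Int finite_unique_lits[OF R] One_nat_def)
  have "unique_lits ?R \<subseteq> (unique_lits F - {x, - x}) \<union> ?S" using cases by blast
  then have "card (unique_lits ?R) \<le> card ((unique_lits F - {x, - x}) \<union> ?S)"
    by (intro card_mono) (auto simp: finite_unique_lits[OF F] finite_unique_lits[OF R])
  also have "\<dots> \<le> card (unique_lits F - {x, - x}) + card ?S" by (rule card_Un_le)
  also have "\<dots> \<le> card (unique_lits F) - 2 + 1"
    using S True x x0 card_Diff_subset[of "{x, - x}" "unique_lits F"] by auto
  also have "\<dots> < card (unique_lits F)"
    using card_mono[of "unique_lits F" "{x, - x}"] True x x0 finite_unique_lits[OF F] by auto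
  finally show ?thesis .
qed

text \<open>Each elimination of a unique literal costs one variable and at least one unique literal,
  until the clause-set is nonsingular or has no variables left.\<close>

lemma nvars_le_unique_lits:
  fixes B :: int
  assumes F: "unsat_hitting F" and n: "nvars F > 0" and d: "deficiency F = k" and B: "B \<ge> - 1"
    and bound: "\<And>G. unsat_hitting G \<Longrightarrow> nonsingular G \<Longrightarrow> deficiency G = k \<Longrightarrow> nvars G > 0
      \<Longrightarrow> int (nvars G) \<le> B"
  shows "int (nvars F) \<le> B + int (card (unique_lits F))"
  using F n d
proof (induction "nvars F" arbitrary: F)
  case (Suc m F)
  note F = Suc.prems(1)
  show ?case
  proof (cases "nonsingular F")
    case True
    then show ?thesis using bound Suc.prems by fastforce
  next
    case False
    then obtain x where x: "x \<in> unique_lits F" using nonsingular_iff[OF F] by blast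
    obtain H where H: "H \<in> F" "x \<in> H" using x unique_lits_iff by blast
    have x0: "x \<noteq> 0" using uh_literal[OF F H(1,2)] by auto
    let ?R = "restrict_lit F x"
    have R: "unsat_hitting ?R" "deficiency ?R = k" "m = nvars ?R"
      using restrict_unsat_hitting[OF F x0] deficiency_restrict_unique[OF F x] Suc
        nvars_restrict_unique[OF F x] by auto
    show ?thesis
    proof (cases "nvars ?R > 0")
      case True
      then have "int (nvars ?R) \<le> B + int (card (unique_lits ?R))" using Suc R by blast
      then show ?thesis
        using card_unique_lits_restrict[OF F x] nvars_restrict_unique[OF F x] by simp
    next
      \<comment> \<open>\<open>F\<close> has only the variable of \<open>x\<close>, and both its
        literals are unique; the claim becomes \<open>1 \<le> B + 2\<close>, which is why
        \<open>B\<close> may go down to \<open>- 1\<close> but no further.\<close>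
      case False
      then have "vars ?R = {}" using finite_vars[OF R(1)] unfolding nvars_def by simp
      then have "vars F \<subseteq> {\<bar>x\<bar>}" using vars_restrict_unique[OF F x] by auto
      then have lit: "y = x \<or> y = - x" if "D \<in> F" "y \<in> D" for D y
      proof -
        have "\<bar>y\<bar> \<in> vars F" using that unfolding vars_def by blast
        then show ?thesis using \<open>vars F \<subseteq> {\<bar>x\<bar>}\<close> by (auto simp: abs_eq_iff)
      qed
      obtain D where D: "D \<in> F" "- x \<in> D" using uh_complement_occurs[OF F H] by blast
      have "E = D" if "E \<in> F" "- x \<in> E" for E
      proof -
        have "E \<subseteq> {- x}" "D \<subseteq> {- x}"
          using lit that D uh_literal[OF F D] uh_literal[OF F that] by fastforce+
        then show ?thesis using that D by blast
      qed
      then have "- x \<in> unique_lits F" unfolding unique_lits_iff using D by blast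
      then have "card {x, - x} \<le> card (unique_lits F)"
        by (intro card_mono finite_unique_lits[OF F]) (use x in auto)
      moreover have "card {x, - x} = 2" using x0 by auto
      ultimately show ?thesis using B R False nvars_restrict_unique[OF F x] by simp
    qed
  qed
qed simp

text \<open>In deficiency 1 no nonsingular clause-set has variables, so the bound \<open>- 1\<close>
  is available.\<close>

lemma nvars_lt_unique_lits:
  assumes "unsat_hitting F" "nvars F > 0" "deficiency F = 1"
  shows "nvars F < card (unique_lits F)"
proof -
  have "int (nvars F) \<le> - 1 + int (card (unique_lits F))"
    using nvars_le_unique_lits[OF assms, of "- 1"] deficiency_1_singular nonsingular_iff by auto
  then show ?thesis by simp
qed

subsection \<open>Clause-factors\<close>

text \<open>Excluding clause-sets without variables admits the bound \<open>- 1\<close>, the value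
  of \<open>4 * k - 5\<close> at \<open>k = 1\<close>, in spite of \<open>{{}}\<close>.\<close>

definition nonsingular_bound :: "int \<Rightarrow> int \<Rightarrow> bool" where
  "nonsingular_bound k B \<longleftrightarrow> (\<forall>G. unsat_hitting G \<longrightarrow> nonsingular G \<longrightarrow> deficiency G = k \<longrightarrow>
    nvars G > 0 \<longrightarrow> int (nvars G) \<le> B)"

lemma card_shared_lits:
  assumes "finite S" "L \<subseteq> {x :: int. \<bar>x\<bar> \<in> S}"
  shows "card L \<le> 2 * card S"
proof -
  have "L \<subseteq> S \<union> uminus ` S"
  proof
    fix x assume "x \<in> L"
    then have "\<bar>x\<bar> \<in> S" using assms by blast
    then show "x \<in> S \<union> uminus ` S" by (cases "x \<ge> 0") (auto simp: image_iff intro: bexI[of _ "- x"])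
  qed
  then have "card L \<le> card (S \<union> uminus ` S)" using assms by (intro card_mono) auto
  also have "\<dots> \<le> card S + card (uminus ` S)" by (rule card_Un_le)
  also have "\<dots> \<le> 2 * card S" using card_image_le[OF assms(1), of uminus] by simp
  finally show ?thesis .
qed

section \<open>Splitting at a nontrivial clause-factor\<close>

locale nontrivial_factor =
  fixes F F' :: "int set set"
  assumes F: "unsat_hitting F" and factor: "clause_factor_of F' F"
    and nontrivial: "\<not> trivial_factor_of F' F"
begin

definition core :: "int set" where "core = \<Inter>F'"

definition residue :: "int set set" where "residue = (\<lambda>D. D - core) ` F'"

definition quotient :: "int set set" where "quotient = insert core (F - F')"

lemma sub: "F' \<subseteq> F" and ne: "F' \<noteq> {}"
  using factor unfolding clause_factor_of_def clause_factor_def by auto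

lemma core_subset: "D \<in> F' \<Longrightarrow> core \<subseteq> D"
  unfolding core_def by blast

lemma residue_unsat: "\<not> satisfiable residue"
  using factor unfolding clause_factor_of_def clause_factor_def residue_def core_def by auto

lemma clause_set_residue: "clause_set residue"
  using F sub unfolding residue_def unsat_hitting_def clause_set_def
  by (auto intro: clause_subset finite_subset)

lemma residue_unsat_hitting: "unsat_hitting residue"
  unfolding unsat_hitting_def
proof (intro conjI)
  show "hitting residue"
    unfolding hitting_def residue_def
  proof (intro ballI impI)
    fix C D assume "C \<in> (\<lambda>D. D - core) ` F'" "D \<in> (\<lambda>D. D - core) ` F'" "C \<noteq> D"
    then obtain C' D' where CD: "C' \<in> F'" "D' \<in> F'" "C = C' - core" "D = D' - core" "C' \<noteq> D'" by blast
    then have "C' \<in> F" "D' \<in> F" using sub by auto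
    then obtain x where x: "x \<in> C'" "- x \<in> D'"
      using F CD(5) unfolding unsat_hitting_def hitting_def by metis
    have "x \<notin> core" "- x \<notin> core"
      using x core_subset[OF CD(1)] core_subset[OF CD(2)]
        uh_literal[OF F \<open>C' \<in> F\<close> x(1)] uh_literal[OF F \<open>D' \<in> F\<close> x(2)] by auto
    then show "\<exists>x\<in>C. - x \<in> D" using x CD by blast
  qed
qed (fact clause_set_residue residue_unsat)+

lemma factor_covers:
  assumes "total_lits T" "core \<subseteq> T"
  obtains D where "D \<in> F'" "D \<subseteq> T"
proof -
  obtain E where "E \<in> residue" "E \<subseteq> T" using uh_ex[OF residue_unsat_hitting assms(1)] .
  then show ?thesis using that assms(2) unfolding residue_def by blast
qed

lemma core_clause: "clause core"
  using ne sub core_subset uh_clause[OF F] clause_subset by blast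

lemma core_notin: "core \<notin> F - F'"
proof
  assume c: "core \<in> F - F'"
  obtain D where "D \<in> F'" using ne by blast
  then have "core = D" using uh_subset_eq[OF F, of core D] c sub core_subset by blast
  then show False using c \<open>D \<in> F'\<close> by blast
qed

text \<open>By \<open>factor_covers\<close>, an assignment falsifies \<open>core\<close> iff it
  falsifies a clause of \<open>F'\<close>, so merging \<open>F'\<close> into \<open>core\<close>
  preserves the partition.\<close>

lemma quotient_unsat_hitting: "unsat_hitting quotient"
  unfolding unsat_hitting_iff_partition
proof (intro conjI allI impI)
  show "clause_set quotient"
    using F core_clause unfolding quotient_def unsat_hitting_def clause_set_def by auto
  fix T assume T: "total_lits T"
  show "\<exists>!C. C \<in> quotient \<and> C \<subseteq> T"
  proof (cases "core \<subseteq> T")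
    case True
    then obtain D where D: "D \<in> F'" "D \<subseteq> T" using factor_covers[OF T] by blast
    show ?thesis
    proof (rule ex1I)
      show "core \<in> quotient \<and> core \<subseteq> T" using True unfolding quotient_def by blast
      fix C assume C: "C \<in> quotient \<and> C \<subseteq> T"
      show "C = core"
      proof (rule ccontr)
        assume "C \<noteq> core"
        then have "C \<in> F" "C \<notin> F'" using C unfolding quotient_def by auto
        moreover have "D \<in> F" using D sub by blast
        ultimately show False using uh_unique[OF F T, of C D] C D by blast
      qed
    qed
  next
    case False
    obtain D where D: "D \<in> F" "D \<subseteq> T" using uh_ex[OF F T] .
    have "D \<notin> F'" using False D core_subset by blast
    show ?thesis
    proof (rule ex1I)
      show "D \<in> quotient \<and> D \<subseteq> T" using D \<open>D \<notin> F'\<close> unfolding quotient_def by blast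
      fix C assume C: "C \<in> quotient \<and> C \<subseteq> T"
      then have "C \<in> F" using False unfolding quotient_def by blast
      then show "C = D" using uh_unique[OF F T, of C D] C D by blast
    qed
  qed
qed

lemma card_residue: "card residue = card F'"
  unfolding residue_def
proof (rule card_image, rule inj_onI)
  fix C D assume "C \<in> F'" "D \<in> F'" "C - core = D - core"
  then show "C = D" using core_subset by blast
qed

lemma finite_F': "finite F'"
  using sub uh_finite[OF F] finite_subset by blast

lemma card_quotient: "card quotient + card residue = card F + 1"
proof -
  have "card quotient = Suc (card (F - F'))"
    unfolding quotient_def using core_notin uh_finite[OF F] by simp
  moreover have "card (F - F') + card F' = card F"
    using card_Diff_subset[OF finite_F' sub] card_mono[OF uh_finite[OF F] sub] by simp
  ultimately show ?thesis using card_residue by simp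
qed

lemma vars_decomp: "vars F = vars quotient \<union> vars residue"
proof -
  have "\<Union>F = \<Union>quotient \<union> \<Union>residue"
  proof
    show "\<Union>F \<subseteq> \<Union>quotient \<union> \<Union>residue" unfolding quotient_def residue_def by auto
    obtain D where "D \<in> F'" using ne by blast
    then have "core \<subseteq> \<Union>F" using core_subset[of D] sub by blast
    then show "\<Union>quotient \<union> \<Union>residue \<subseteq> \<Union>F" unfolding quotient_def residue_def using sub by auto
  qed
  then show ?thesis unfolding vars_def by (simp add: image_Un)
qed

definition shared :: nat where "shared = card (vars quotient \<inter> vars residue)"

lemma nvars_decomp: "nvars quotient + nvars residue = nvars F + shared"
  unfolding nvars_def shared_def vars_decomp
  using card_Un_Int finite_vars quotient_unsat_hitting residue_unsat_hitting by blast

lemma deficiency_decomp: "deficiency quotient + deficiency residue + int shared = deficiency F + 1"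
  using nvars_decomp card_quotient unfolding deficiency_def by simp

text \<open>A residue without variables is a single clause, so \<open>F'\<close> would be trivial;
  \<open>nvars_quotient_pos\<close> excludes the other trivial factor,
  \<open>F' = F\<close>.\<close>

lemma nvars_residue_pos: "nvars residue > 0"
proof (rule ccontr)
  assume "\<not> nvars residue > 0"
  then have "card residue = 1" using nvars_0_iff[OF residue_unsat_hitting] by simp
  then show False using card_residue nontrivial unfolding trivial_factor_of_def by simp
qed

lemma nvars_quotient_pos: "nvars quotient > 0"
proof (rule ccontr)
  assume "\<not> nvars quotient > 0"
  then have "quotient = {{}}" using nvars_0_iff[OF quotient_unsat_hitting] by simp
  then have "F - F' = {}" using core_notin unfolding quotient_def by auto
  then have "F' = F" using sub by blast
  then show False using nontrivial F unfolding trivial_factor_of_def unsat_hitting_def by blast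
qed

lemma not_in_core_residue: "x \<in> \<Union>residue \<Longrightarrow> x \<notin> core \<and> - x \<notin> core"
proof
  assume "x \<in> \<Union>residue"
  then obtain D where D: "D \<in> F'" "x \<in> D" "x \<notin> core" unfolding residue_def by blast
  then show "x \<notin> core" by blast
  have "D \<in> F" using D sub by blast
  then show "- x \<notin> core" using core_subset[OF D(1)] uh_literal[OF F _ D(2)] by blast
qed

section \<open>Unique literals of the two parts when \<open>F\<close> is nonsingular\<close>

context
  assumes nonsing: "nonsingular F"
begin

lemma no_unique: "x \<notin> unique_lits F"
  using nonsing nonsingular_iff[OF F] by blast

text \<open>In \<open>F\<close> the literal occurs at least twice. Not being in the core, it occurs
  only once within \<open>F'\<close>, so it also occurs in \<open>F - F'\<close> and hence in the
  quotient.\<close>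

lemma unique_lits_residue_shared:
  assumes x: "x \<in> unique_lits residue"
  shows "\<bar>x\<bar> \<in> vars quotient \<inter> vars residue"
proof -
  obtain E where E: "E \<in> residue" "x \<in> E" "\<forall>D\<in>residue. x \<in> D \<longrightarrow> D = E"
    using x unfolding unique_lits_iff by blast
  then obtain E' where E': "E' \<in> F'" "E = E' - core" unfolding residue_def by blast
  have xr: "x \<in> \<Union>residue" using E by blast
  have "x \<in> \<Union>quotient"
  proof (rule ccontr)
    assume n: "x \<notin> \<Union>quotient"
    have "D = E'" if "D \<in> F" "x \<in> D" for D
    proof -
      have D: "D \<in> F'" using n that unfolding quotient_def by blast
      then have "D - core \<in> residue" "x \<in> D - core"
        using that(2) not_in_core_residue[OF xr] unfolding residue_def by auto
      then have "D - core = E" using E(3) by simp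
      then show ?thesis using E' core_subset[OF D] core_subset[OF E'(1)] by blast
    qed
    then have "x \<in> unique_lits F" unfolding unique_lits_iff using E E' sub by blast
    then show False using no_unique by blast
  qed
  then show ?thesis
    using xr abs_mem_vars_iff[OF quotient_unsat_hitting] abs_mem_vars_iff[OF residue_unsat_hitting]
    by blast
qed

text \<open>A further occurrence in \<open>F\<close> must lie in \<open>F'\<close>, hence in the
  residue. Literals of \<open>core\<close> are exempt: the quotient counts them once for all clauses
  of \<open>F'\<close>.\<close>

lemma unique_lits_quotient_shared:
  assumes x: "x \<in> unique_lits quotient" and c: "x \<notin> core"
  shows "\<bar>x\<bar> \<in> vars quotient \<inter> vars residue"
proof -
  obtain E where E: "E \<in> quotient" "x \<in> E" "\<forall>D\<in>quotient. x \<in> D \<longrightarrow> D = E"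
    using x unfolding unique_lits_iff by blast
  have EF: "E \<in> F - F'" using E c unfolding quotient_def by blast
  have xq: "x \<in> \<Union>quotient" using E by blast
  have "x \<in> \<Union>residue"
  proof (rule ccontr)
    assume n: "x \<notin> \<Union>residue"
    have "D = E" if "D \<in> F" "x \<in> D" for D
    proof -
      have "D \<notin> F'" using n that c unfolding residue_def by blast
      then show ?thesis using E(3) that unfolding quotient_def by blast
    qed
    then have "x \<in> unique_lits F" unfolding unique_lits_iff using E EF by blast
    then show False using no_unique by blast
  qed
  then show ?thesis
    using xq abs_mem_vars_iff[OF quotient_unsat_hitting] abs_mem_vars_iff[OF residue_unsat_hitting]
    by blast
qed

lemma card_unique_lits_residue: "card (unique_lits residue) \<le> 2 * shared"
  unfolding shared_def
  using unique_lits_residue_shared finite_vars[OF residue_unsat_hitting]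
  by (intro card_shared_lits) auto

text \<open>The additional 1 accounts for \<open>core\<close>, a clause of the quotient and
  therefore containing at most one unique literal.\<close>

lemma card_unique_lits_quotient: "card (unique_lits quotient) \<le> 2 * shared + 1"
proof -
  have f: "finite (unique_lits quotient)" using finite_unique_lits[OF quotient_unsat_hitting] .
  have "card (unique_lits quotient - core) \<le> 2 * shared"
    unfolding shared_def
    using unique_lits_quotient_shared finite_vars[OF residue_unsat_hitting]
    by (intro card_shared_lits) auto
  moreover have "core \<in> quotient" unfolding quotient_def by blast
  then have "\<And>x y. x \<in> unique_lits quotient \<inter> core \<Longrightarrow> y \<in> unique_lits quotient \<inter> core \<Longrightarrow> x = y"
    using unique_lits_clause_eq[OF quotient_unsat_hitting] by blast
  then have "card (unique_lits quotient \<inter> core) \<le> 1"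
    using f by (metis card_le_Suc0_iff_eq finite_Int One_nat_def)
  ultimately show ?thesis
    using card_Un_le[of "unique_lits quotient - core" "unique_lits quotient \<inter> core"]
    by (simp add: Un_Diff_Int)
qed

text \<open>By \<open>deficiency_decomp\<close> this fails only if one part has deficiency 1 and
  nothing is shared. But a part of deficiency 1 has more unique literals than variables, hence at
  least two, while without sharing the residue has none and the quotient at most one.\<close>

lemma deficiency_smaller: "deficiency quotient < deficiency F" "deficiency residue < deficiency F"
proof -
  have "deficiency quotient \<ge> 1" "deficiency residue \<ge> 1"
    using deficiency_pos quotient_unsat_hitting residue_unsat_hitting by auto
  moreover have "shared > 0" if "deficiency residue = 1"
    using nvars_lt_unique_lits[OF residue_unsat_hitting nvars_residue_pos that]
      card_unique_lits_residue by simp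
  moreover have "shared > 0" if "deficiency quotient = 1"
    using nvars_lt_unique_lits[OF quotient_unsat_hitting nvars_quotient_pos that]
      card_unique_lits_quotient nvars_quotient_pos by simp
  ultimately show "deficiency quotient < deficiency F" "deficiency residue < deficiency F"
    using deficiency_decomp by linarith+
qed

text \<open>The parts have at most \<open>2 * shared\<close> and \<open>2 * shared + 1\<close>
  unique literals; subtracting the \<open>shared\<close> variables counted twice leaves
  \<open>1 + 3 * shared\<close>.\<close>

lemma nvars_bound:
  fixes f :: "int \<Rightarrow> int"
  assumes f: "\<And>j. 1 \<le> j \<Longrightarrow> j < deficiency F \<Longrightarrow> f j \<ge> - 1 \<and> nonsingular_bound j (f j)"
  shows "int (nvars F) \<le> f (deficiency quotient) + f (deficiency residue) + 1 + 3 * int shared"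
proof -
  have *: "int (nvars H) \<le> f (deficiency H) + int (card (unique_lits H))"
    if H: "unsat_hitting H" "nvars H > 0" "deficiency H < deficiency F" for H
  proof (rule nvars_le_unique_lits[OF H(1,2) refl])
    have fH: "f (deficiency H) \<ge> - 1 \<and> nonsingular_bound (deficiency H) (f (deficiency H))"
      using f[of "deficiency H"] deficiency_pos[OF H(1)] H(3) by blast
    then show "- 1 \<le> f (deficiency H)" by blast
    show "int (nvars G) \<le> f (deficiency H)"
      if "unsat_hitting G" "nonsingular G" "deficiency G = deficiency H" "0 < nvars G" for G
      using fH that unfolding nonsingular_bound_def by blast
  qed
  show ?thesis
    using *[OF quotient_unsat_hitting nvars_quotient_pos deficiency_smaller(1)]
      *[OF residue_unsat_hitting nvars_residue_pos deficiency_smaller(2)]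
      card_unique_lits_residue card_unique_lits_quotient nvars_decomp by linarith
qed

end

end

section \<open>Clause-factors arising from unique literals and from full pairs\<close>

lemma clause_factor_if_covering:
  assumes F: "unsat_hitting F" and sub: "F' \<subseteq> F" and ne: "F' \<noteq> {}"
    and cover: "\<And>T. total_lits T \<Longrightarrow> \<exists>D\<in>F'. D - \<Inter>F' \<subseteq> T"
  shows "clause_factor_of F' F"
proof -
  have cs: "clause_set F'" using F sub finite_subset unfolding unsat_hitting_def clause_set_def by blast
  then have "clause_set ((\<lambda>D. D - \<Inter>F') ` F')"
    unfolding clause_set_def by (auto intro: clause_subset)
  then have "\<not> satisfiable ((\<lambda>D. D - \<Inter>F') ` F')" using cover by (simp add: unsat_iff_total)
  then show ?thesis using sub ne cs unfolding clause_factor_of_def clause_factor_def by blast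
qed

lemma deficiency_le_1_if_card_2:
  assumes F: "unsat_hitting F" and c: "card F = 2"
  shows "deficiency F \<le> 1"
proof -
  have "nvars F \<noteq> 0" using c nvars_0_iff[OF F] by auto
  then show ?thesis unfolding deficiency_def using c by simp
qed

text \<open>For a unique literal \<open>x\<close> in \<open>H\<close>, the clauses with
  \<open>x\<close> or \<open>- x\<close> form a factor with core \<open>H - {x}\<close>. If it is
  all of \<open>F\<close>, then the clauses with \<open>- x\<close> form a factor too; if this one
  is a single clause, \<open>F\<close> has two clauses and deficiency at most 1.\<close>

lemma irreducible_nonsingular:
  assumes F: "unsat_hitting F" and irr: "clause_irreducible F" and d: "deficiency F \<ge> 2"
  shows "nonsingular F"
proof (rule ccontr)
  assume "\<not> nonsingular F"
  then obtain x where x: "x \<in> unique_lits F" using nonsingular_iff[OF F] by blast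
  obtain H where H: "H \<in> F" "x \<in> H" and uniq: "\<And>D. D \<in> F \<Longrightarrow> x \<in> D \<Longrightarrow> D = H"
    using unique_lits_obtain[OF x] by blast
  have x0: "x \<noteq> 0" using uh_literal[OF F H] by blast
  obtain D0 where D0: "D0 \<in> F" "- x \<in> D0" using uh_complement_occurs[OF F H] by blast
  have "x \<notin> D0" using uh_literal[OF F D0] by simp
  define F' where "F' = {D \<in> F. x \<in> D \<or> - x \<in> D}"
  have HF': "H \<in> F'" "D0 \<in> F'" using H D0 unfolding F'_def by auto
  have HD: "H - {x} \<subseteq> D" if "D \<in> F'" for D
    using that uniq unique_lit_subset[OF F x H] unfolding F'_def by blast
  have core: "\<Inter>F' = H - {x}" using HD HF' \<open>x \<notin> D0\<close> by blast
  have "clause_factor_of F' F"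
  proof (rule clause_factor_if_covering[OF F])
    fix T assume T: "total_lits T"
    have cl: "clause (H - {x})" using clause_subset[OF uh_clause[OF F H(1)]] by blast
    \<comment> \<open>\<open>T\<close> is altered to falsify \<open>H - {x}\<close>. The clause
      falsified by \<open>T'\<close> mentions the variable of \<open>x\<close>; otherwise it and
      \<open>H\<close> would both be falsified after making \<open>x\<close> false.\<close>
    define T' where "T' = (H - {x}) \<union> (T - uminus ` (H - {x}))"
    have T': "total_lits T'" unfolding T'_def using total_override[OF cl T] .
    obtain D where D: "D \<in> F" "D \<subseteq> T'" using uh_ex[OF F T'] .
    have "D \<in> F'"
    proof (rule ccontr)
      assume n: "D \<notin> F'"
      then have "D \<subseteq> force x T'" using D unfolding F'_def by auto
      moreover have "H \<subseteq> force x T'"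
        using uh_literal[OF F H] unfolding T'_def by auto
      ultimately have "D = H" using uh_unique[OF F total_force[OF T' x0]] D H by blast
      then show False using n HF' by blast
    qed
    moreover have "D - (H - {x}) \<subseteq> T" using D unfolding T'_def by blast
    ultimately show "\<exists>D\<in>F'. D - \<Inter>F' \<subseteq> T" unfolding core by blast
  qed (use HF' in \<open>auto simp: F'_def\<close>)
  then have triv: "trivial_factor_of F' F" using irr unfolding clause_irreducible_def by blast
  have "H \<noteq> D0" using H \<open>x \<notin> D0\<close> by blast
  then have "card F' \<noteq> 1" using HF' by (auto simp: card_1_singleton_iff)
  then have FF: "F' = F" using triv unfolding trivial_factor_of_def by blast
  have H1: "H = {x}"
  proof (rule ccontr)
    assume "H \<noteq> {x}"
    then obtain y where y: "y \<in> H" "y \<noteq> x" using H by blast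
    obtain D where D: "D \<in> F" "- y \<in> D" using uh_complement_occurs[OF F H(1) y(1)] by blast
    then have "y \<in> D" using HD FF y by blast
    then show False using uh_literal[OF F D] by simp
  qed
  define F'' where "F'' = {D \<in> F. - x \<in> D}"
  have "clause_factor_of F'' F"
  proof (rule clause_factor_if_covering[OF F])
    fix T assume T: "total_lits T"
    have T': "total_lits (force (- x) T)" using total_force T x0 by simp
    obtain D where D: "D \<in> F" "D \<subseteq> force (- x) T" using uh_ex[OF F T'] .
    have "x \<notin> D" using D x0 by auto
    then have "D \<in> F''" using D FF unfolding F'_def F''_def by blast
    moreover have "- x \<in> \<Inter>F''" unfolding F''_def by blast
    ultimately show "\<exists>D\<in>F''. D - \<Inter>F'' \<subseteq> T" using D by (intro bexI[of _ D]) auto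
  qed (use D0 in \<open>auto simp: F''_def\<close>)
  then have triv: "trivial_factor_of F'' F" using irr unfolding clause_irreducible_def by blast
  have "- x \<notin> H" using uh_literal[OF F H] by blast
  then have "F'' \<noteq> F" using H unfolding F''_def by blast
  then have "card F'' = 1" using triv unfolding trivial_factor_of_def by blast
  moreover have "F = insert H F''" using FF uniq H unfolding F'_def F''_def by blast
  moreover have "H \<notin> F''" using \<open>- x \<notin> H\<close> unfolding F''_def by blast
  moreover have "finite F''" unfolding F''_def using uh_finite[OF F] by simp
  ultimately have "card F = 2" by (metis card_insert_disjoint one_add_one plus_1_eq_Suc)
  then show False using deficiency_le_1_if_card_2[OF F] d by simp
qed

text \<open>The core is \<open>E\<close>, leaving \<open>{y}\<close> and \<open>{- y}\<close>;
  deficiency at least 2 prevents the pair from being all of \<open>F\<close>.\<close>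

lemma full_pair_factor:
  assumes F: "unsat_hitting F" and d: "deficiency F \<ge> 2"
    and P: "insert y E \<in> F" "insert (- y) E \<in> F" and y: "y \<notin> E" "- y \<notin> E"
  shows "nontrivial_factor F {insert y E, insert (- y) E}"
proof
  have y0: "y \<noteq> 0" using uh_literal[OF F P(1), of y] by simp
  have I: "\<Inter>{insert y E, insert (- y) E} = E" using y y0 by auto
  show "unsat_hitting F" by fact
  show "clause_factor_of {insert y E, insert (- y) E} F"
  proof (rule clause_factor_if_covering[OF F])
    fix T assume "total_lits T"
    then have "y \<in> T \<or> - y \<in> T" using y0 unfolding total_lits_def by blast
    then show "\<exists>D\<in>{insert y E, insert (- y) E}. D - \<Inter>{insert y E, insert (- y) E} \<subseteq> T"
      unfolding I by auto
  qed (use P in auto)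
  have "insert y E \<noteq> insert (- y) E" using y y0 by auto
  then have c: "card {insert y E, insert (- y) E} = 2" by simp
  then show "\<not> trivial_factor_of {insert y E, insert (- y) E} F"
    unfolding trivial_factor_of_def using deficiency_le_1_if_card_2[OF F] d by auto
qed

lemma reducible_obtains_factor:
  assumes "unsat_hitting F" "clause_reducible F"
  obtains F' where "nontrivial_factor F F'"
  using assms that unfolding clause_irreducible_def nontrivial_factor_def by blast

subsection \<open>Non-full subsumption flips\<close>

lemma nfs_step_obtains:
  assumes "nfs_step F G"
  obtains E x y where "nfs_params E x y" "nfs_pair E x y \<subseteq> F" "nfs_flip E x y \<inter> F = {}"
    "G = (F - nfs_pair E x y) \<union> nfs_flip E x y"
  using assms unfolding nfs_step_def by blast

text \<open>Pair and flip are two ways to split the same set of assignments, those falsifying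
  \<open>E\<close> together with \<open>x\<close> or \<open>y\<close>.\<close>

lemma nfs_flip_partition:
  assumes p: "nfs_params E x y" and T: "total_lits T"
  shows "(\<exists>C\<in>nfs_pair E x y. C \<subseteq> T) \<longleftrightarrow> E \<subseteq> T \<and> (x \<in> T \<or> y \<in> T)"
    and "(\<exists>C\<in>nfs_flip E x y. C \<subseteq> T) \<longleftrightarrow> E \<subseteq> T \<and> (x \<in> T \<or> y \<in> T)"
    and "C \<in> nfs_flip E x y \<Longrightarrow> D \<in> nfs_flip E x y \<Longrightarrow> C \<subseteq> T \<Longrightarrow> D \<subseteq> T \<Longrightarrow> C = D"
proof -
  have "x \<noteq> 0" "y \<noteq> 0" using p unfolding nfs_params_def by auto
  then have n: "- x \<in> T \<longleftrightarrow> x \<notin> T" "- y \<in> T \<longleftrightarrow> y \<notin> T" using T unfolding total_lits_def by auto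
  show "(\<exists>C\<in>nfs_pair E x y. C \<subseteq> T) \<longleftrightarrow> E \<subseteq> T \<and> (x \<in> T \<or> y \<in> T)"
    "(\<exists>C\<in>nfs_flip E x y. C \<subseteq> T) \<longleftrightarrow> E \<subseteq> T \<and> (x \<in> T \<or> y \<in> T)"
    unfolding nfs_pair_def nfs_flip_def using n by auto
  show "C \<in> nfs_flip E x y \<Longrightarrow> D \<in> nfs_flip E x y \<Longrightarrow> C \<subseteq> T \<Longrightarrow> D \<subseteq> T \<Longrightarrow> C = D"
    unfolding nfs_flip_def using n(2) by (elim insertE emptyE) simp_all
qed

lemma nfs_step_unsat_hitting:
  assumes F: "unsat_hitting F" and step: "nfs_step F G"
  shows "unsat_hitting G"
proof -
  obtain E x y where p: "nfs_params E x y" and P: "nfs_pair E x y \<subseteq> F"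
    and G: "G = (F - nfs_pair E x y) \<union> nfs_flip E x y"
    using nfs_step_obtains[OF step] by metis
  show ?thesis
    unfolding unsat_hitting_iff_partition
  proof (intro conjI allI impI)
    have "clause (E \<union> {x, - y})" "clause (E \<union> {y})"
      using p unfolding nfs_params_def clause_def by auto
    then show "clause_set G"
      using F unfolding G nfs_flip_def unsat_hitting_def clause_set_def by auto
    fix T assume T: "total_lits T"
    obtain D where D: "D \<in> F" "D \<subseteq> T" using uh_ex[OF F T] .
    have un: "C = D" if "C \<in> F" "C \<subseteq> T" for C using uh_unique[OF F T] that D by blast
    show "\<exists>!C. C \<in> G \<and> C \<subseteq> T"
    proof (cases "E \<subseteq> T \<and> (x \<in> T \<or> y \<in> T)")
      case True
      obtain C where C: "C \<in> nfs_pair E x y" "C \<subseteq> T" using nfs_flip_partition(1)[OF p T] True by blast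
      then have "D \<in> nfs_pair E x y" using un[of C] P by blast
      then have flip: "C \<in> G \<and> C \<subseteq> T \<longleftrightarrow> C \<in> nfs_flip E x y \<and> C \<subseteq> T" for C
        unfolding G using un[of C] by blast
      obtain C' where C': "C' \<in> nfs_flip E x y" "C' \<subseteq> T" using nfs_flip_partition(2)[OF p T] True by blast
      show ?thesis
      proof (rule ex1I)
        show "C' \<in> G \<and> C' \<subseteq> T" using C' flip by blast
        show "C'' = C'" if "C'' \<in> G \<and> C'' \<subseteq> T" for C''
          using nfs_flip_partition(3)[OF p T] C' flip[of C''] that by blast
      qed
    next
      case False
      have "D \<notin> nfs_pair E x y" using nfs_flip_partition(1)[OF p T] False D by blast
      moreover have "\<not> (\<exists>C\<in>nfs_flip E x y. C \<subseteq> T)" using nfs_flip_partition(2)[OF p T] False by blast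
      ultimately have "C \<in> G \<and> C \<subseteq> T \<longleftrightarrow> C = D" for C unfolding G using un[of C] D by blast
      then show ?thesis by simp
    qed
  qed
qed

lemma nfs_step_vars:
  assumes F: "unsat_hitting F" and step: "nfs_step F G"
  shows "vars G = vars F"
proof -
  obtain E x y where p: "nfs_params E x y" and P: "nfs_pair E x y \<subseteq> F"
    and G: "G = (F - nfs_pair E x y) \<union> nfs_flip E x y"
    using nfs_step_obtains[OF step] by metis
  have "vars (nfs_pair E x y) = vars (nfs_flip E x y)"
    unfolding vars_def nfs_pair_def nfs_flip_def by auto
  moreover have "vars F = vars (F - nfs_pair E x y) \<union> vars (nfs_pair E x y)"
    using P unfolding vars_def by blast
  moreover have "vars G = vars (F - nfs_pair E x y) \<union> vars (nfs_flip E x y)"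
    unfolding G vars_def by blast
  ultimately show ?thesis by simp
qed

lemma nfs_step_card:
  assumes F: "unsat_hitting F" and step: "nfs_step F G"
  shows "card G = card F"
proof -
  obtain E x y where p: "nfs_params E x y" and P: "nfs_pair E x y \<subseteq> F"
    and N: "nfs_flip E x y \<inter> F = {}" and G: "G = (F - nfs_pair E x y) \<union> nfs_flip E x y"
    using nfs_step_obtains[OF step] by metis
  have "E \<union> {x} \<noteq> E \<union> {- x, y}" "E \<union> {x, - y} \<noteq> E \<union> {y}"
    using p unfolding nfs_params_def by auto
  then have c: "card (nfs_pair E x y) = 2" "card (nfs_flip E x y) = 2"
    unfolding nfs_pair_def nfs_flip_def by auto
  have fin: "finite (nfs_pair E x y)" "finite (nfs_flip E x y)" "finite F"
    unfolding nfs_pair_def nfs_flip_def using uh_finite[OF F] by auto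
  have "card G = card (F - nfs_pair E x y) + card (nfs_flip E x y)"
    unfolding G using fin N by (intro card_Un_disjoint) auto
  also have "\<dots> = card F"
    using card_Diff_subset[OF fin(1) P] card_mono[OF fin(3) P] c by simp
  finally show ?thesis .
qed

lemma nfs_step_invariants:
  assumes "unsat_hitting F" "nfs_step F G"
  shows "nvars G = nvars F" "deficiency G = deficiency F"
  using nfs_step_vars[OF assms] nfs_step_card[OF assms] unfolding nvars_def deficiency_def by auto

text \<open>Only \<open>- x\<close> loses an occurrence: the map \<open>\<phi>\<close> inside the
  proof matches the clauses of \<open>F\<close> injectively with those of \<open>G\<close> and keeps
  every other literal in place.\<close>

lemma nfs_step_unique_lits:
  assumes F: "unsat_hitting F" "nonsingular F"
    and p: "nfs_params E x y" and P: "nfs_pair E x y \<subseteq> F" and N: "nfs_flip E x y \<inter> F = {}"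
    and G: "G = (F - nfs_pair E x y) \<union> nfs_flip E x y"
  shows "unique_lits G \<subseteq> {- x}"
proof
  fix z assume z: "z \<in> unique_lits G"
  have step: "nfs_step F G" using assms unfolding nfs_step_def by blast
  have UG: "unsat_hitting G" using nfs_step_unsat_hitting[OF F(1) step] .
  obtain H where H: "H \<in> G" "z \<in> H" and uH: "\<And>D. D \<in> G \<Longrightarrow> z \<in> D \<Longrightarrow> D = H"
    using unique_lits_obtain[OF z] by blast
  have "\<bar>z\<bar> \<in> vars F"
    using H abs_mem_vars_iff[OF UG] nfs_step_vars[OF F(1) step] by blast
  then have "z \<in> \<Union>F" using abs_mem_vars_iff[OF F(1)] by blast
  moreover have "z \<notin> unique_lits F" using F nonsingular_iff by blast
  ultimately obtain D1 D2 where D: "D1 \<in> F" "D2 \<in> F" "z \<in> D1" "z \<in> D2" "D1 \<noteq> D2"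
    unfolding unique_lits_iff by blast
  show "z \<in> {- x}"
  proof (rule ccontr)
    assume zx: "z \<notin> {- x}"
    define \<phi> where "\<phi> D = (if D = E \<union> {x} then E \<union> {x, - y} else if D = E \<union> {- x, y} then E \<union> {y} else D)" for D
    have "\<phi> D \<in> G \<and> z \<in> \<phi> D" if "D \<in> F" "z \<in> D" for D
      using that zx unfolding \<phi>_def G nfs_pair_def nfs_flip_def by auto
    then have "\<phi> D1 = \<phi> D2" using D uH by metis
    moreover have "E \<union> {x, - y} \<noteq> E \<union> {y}" "E \<union> {x, - y} \<notin> F" "E \<union> {y} \<notin> F"
      using p N unfolding nfs_params_def nfs_flip_def by auto
    ultimately show False using D unfolding \<phi>_def by (auto split: if_splits)
  qed
qed

text \<open>The surplus \<open>s\<close> in \<open>4 * s\<close>, compared with the \<open>3 * s\<close> that a factorisation costs, pays for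
  the variable eliminated after a flip that creates a singular variable.\<close>

definition reducible_bound :: "int \<Rightarrow> (int \<Rightarrow> int) \<Rightarrow> int \<Rightarrow> bool" where
  "reducible_bound k f M \<longleftrightarrow>
    (\<forall>j. 1 \<le> j \<longrightarrow> j < k \<longrightarrow> f j \<ge> - 1 \<and> nonsingular_bound j (f j)) \<and>
    (\<forall>a b s. 1 \<le> a \<longrightarrow> a < k \<longrightarrow> 1 \<le> b \<longrightarrow> b < k \<longrightarrow> 0 \<le> s \<longrightarrow> a + b + s = k + 1 \<longrightarrow>
      f a + f b + 1 + 4 * s \<le> M)"

lemma factor_nvars_bound:
  assumes N: "nontrivial_factor F F'" and n: "nonsingular F" and R: "reducible_bound (deficiency F) f M"
  shows "int (nvars F) \<le> M - int (nontrivial_factor.shared F F')"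
proof -
  interpret nontrivial_factor F F' by fact
  have *: "\<And>j. 1 \<le> j \<Longrightarrow> j < deficiency F \<Longrightarrow> f j \<ge> - 1 \<and> nonsingular_bound j (f j)"
    and M: "\<And>a b s. 1 \<le> a \<Longrightarrow> a < deficiency F \<Longrightarrow> 1 \<le> b \<Longrightarrow> b < deficiency F \<Longrightarrow> 0 \<le> s \<Longrightarrow>
      a + b + s = deficiency F + 1 \<Longrightarrow> f a + f b + 1 + 4 * s \<le> M"
    using R unfolding reducible_bound_def by auto
  have "int (nvars F) \<le> f (deficiency quotient) + f (deficiency residue) + 1 + 3 * int shared"
    using nvars_bound[OF n *] .
  also have "\<dots> \<le> M - int shared"
    using M[of "deficiency quotient" "deficiency residue" "int shared"] deficiency_decomp
      deficiency_pos[OF quotient_unsat_hitting] deficiency_pos[OF residue_unsat_hitting]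
      deficiency_smaller[OF n] by linarith
  finally show ?thesis .
qed

text \<open>The residue has two clauses, hence deficiency 1. As the quotient has smaller deficiency
  than \<open>F\<close>, at least one variable must be shared.\<close>

lemma full_pair_nvars_bound:
  assumes F: "unsat_hitting F" and n: "nonsingular F" and d: "deficiency F \<ge> 2"
    and P: "insert y E \<in> F" "insert (- y) E \<in> F" and y: "y \<notin> E" "- y \<notin> E"
    and R: "reducible_bound (deficiency F) f M"
  shows "int (nvars F) \<le> M - 1"
proof -
  let ?P = "{insert y E, insert (- y) E}"
  interpret nontrivial_factor F ?P using full_pair_factor[OF F d P y] .
  have y0: "y \<noteq> 0" using uh_literal[OF F P(1), of y] by simp
  have "insert y E \<noteq> insert (- y) E" using y y0 by auto
  then have "card residue = 2" using card_residue by simp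
  then have "deficiency residue \<le> 1" using deficiency_le_1_if_card_2[OF residue_unsat_hitting] by simp
  then have "shared \<ge> 1" using deficiency_decomp deficiency_smaller[OF n] by linarith
  then show ?thesis using factor_nvars_bound[OF nontrivial_factor_axioms n R] by linarith
qed

lemma nfs_step_reducible_nvars_bound:
  assumes F: "unsat_hitting F" and irr: "clause_irreducible F" and d: "deficiency F \<ge> 2"
    and step: "nfs_step F G" and red: "clause_reducible G"
    and R: "reducible_bound (deficiency F) f M"
  shows "int (nvars F) \<le> M"
proof -
  have nF: "nonsingular F" using irreducible_nonsingular[OF F irr d] .
  obtain E x y where p: "nfs_params E x y" and P: "nfs_pair E x y \<subseteq> F"
    and N: "nfs_flip E x y \<inter> F = {}" and G: "G = (F - nfs_pair E x y) \<union> nfs_flip E x y"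
    using nfs_step_obtains[OF step] by metis
  have UG: "unsat_hitting G" using nfs_step_unsat_hitting[OF F step] .
  note inv = nfs_step_invariants[OF F step]
  have sub: "unique_lits G \<subseteq> {- x}" using nfs_step_unique_lits[OF F nF p P N G] .
  show ?thesis
  proof (cases "nonsingular G")
    case True
    obtain F' where "nontrivial_factor G F'" using reducible_obtains_factor[OF UG red] .
    from factor_nvars_bound[OF this True] R show ?thesis unfolding inv by fastforce
  next
    case False
    then have u: "- x \<in> unique_lits G" using sub nonsingular_iff[OF UG] by blast
    have x0: "x \<noteq> 0" "y \<noteq> 0" "\<bar>x\<bar> \<noteq> \<bar>y\<bar>" and nE: "x \<notin> E" "- x \<notin> E" "y \<notin> E" "- y \<notin> E"
      using p unfolding nfs_params_def by auto
    let ?R = "restrict_lit G (- x)"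
    have UR: "unsat_hitting ?R" using restrict_unsat_hitting[OF UG] x0 by simp
    have "x \<notin> unique_lits G" using sub x0 by auto
    then have "unique_lits ?R = {}"
      using restrict_unique_lits_subset[OF UG u] sub by auto
    then have nR: "nonsingular ?R" using nonsingular_iff[OF UR] by blast
    have dR: "deficiency ?R = deficiency F" using deficiency_restrict_unique[OF UG u] inv by simp
    \<comment> \<open>Both flip clauses survive the elimination and become a full pair on
      \<open>y\<close>, whose bound \<open>M - 1\<close> compensates for the eliminated
      variable.\<close>
    have mem: "E \<union> {x, - y} \<in> {D \<in> G. - x \<notin> D}" "E \<union> {y} \<in> {D \<in> G. - x \<notin> D}"
      using x0 nE unfolding G nfs_flip_def by auto
    have "(E \<union> {x, - y}) - {x} \<in> ?R" "(E \<union> {y}) - {x} \<in> ?R"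
      unfolding restrict_lit_def minus_minus by (rule imageI, rule mem)+
    moreover have "(E \<union> {x, - y}) - {x} = insert (- y) E" "(E \<union> {y}) - {x} = insert y E"
      using x0 nE by auto
    ultimately have pr: "insert y E \<in> ?R" "insert (- y) E \<in> ?R" by simp_all
    have "int (nvars ?R) \<le> M - 1"
      using full_pair_nvars_bound[OF UR nR _ pr nE(3,4)] d R dR by simp
    then show ?thesis using nvars_restrict_unique[OF UG u] inv by simp
  qed
qed

text \<open>Flips preserve the number of variables and the deficiency, so only the first flip that
  leads to a clause-reducible clause-set matters.\<close>

lemma nfs_reducible_nvars_bound:
  assumes steps: "nfs_step\<^sup>*\<^sup>* F G" and red: "clause_reducible G"
    and F: "unsat_hitting F" "clause_irreducible F" "deficiency F = k"
    and k: "k \<ge> 2" and R: "reducible_bound k f M"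
  shows "int (nvars F) \<le> M"
  using steps F
proof (induction rule: converse_rtranclp_induct)
  case base
  then show ?case using red by blast
next
  case (step F1 F2)
  note inv = nfs_step_invariants[OF step(4,1)]
  show ?case
  proof (cases "clause_irreducible F2")
    case True
    then show ?thesis using step.IH nfs_step_unsat_hitting[OF step(4,1)] inv step(6) by simp
  next
    case False
    then show ?thesis using nfs_step_reducible_nvars_bound[OF step(4,5) _ step(1)] k R step(6) by simp
  qed
qed

text \<open>A nonsingular clause-set is clause-reducible, or can be flipped into a clause-reducible
  one, or is nfs-irreducible; \<open>R\<close> handles the first two cases.\<close>

lemma nonsingular_bound_step:
  assumes k: "k \<ge> 2" and R: "reducible_bound k f M"
    and irr: "\<And>F. nfs_irreducible F \<Longrightarrow> deficiency F = k \<Longrightarrow> int (nvars F) \<le> M"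
  shows "nonsingular_bound k M"
  unfolding nonsingular_bound_def
proof (intro allI impI)
  fix F assume F: "unsat_hitting F" "nonsingular F" "deficiency F = k"
  show "int (nvars F) \<le> M"
  proof (cases "clause_irreducible F")
    case True
    then show ?thesis
      using irr[of F] nfs_reducible_nvars_bound[OF _ _ F(1) True F(3) k R] F
      unfolding nfs_irreducible_def by blast
  next
    case False
    then obtain F' where "nontrivial_factor F F'" using reducible_obtains_factor[OF F(1)] by blast
    then show ?thesis using factor_nvars_bound[of F F' f M] F R by fastforce
  qed
qed

lemma nonsingular_bound_1: "nonsingular_bound 1 B"
  unfolding nonsingular_bound_def using deficiency_1_singular nonsingular_iff by blast

subsection \<open>Deficiency two\<close>

text \<open>A parallel pair of a restriction to \<open>v\<close> that does not come from such a pair of \<open>F\<close>: the four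
  clauses containing \<open>y\<close> or \<open>- y\<close> have the form \<open>P \<union> {v, y}\<close>, \<open>P \<union> {z, y, - v}\<close>,
  \<open>P \<union> {z, - y}\<close>, \<open>P \<union> {- z, - y, v}\<close>, and \<open>U\<close> can only consist of \<open>y\<close>, \<open>- y\<close>, \<open>- z\<close>.\<close>

lemma mixed_pair_unique_lits:
  assumes F: "unsat_hitting F"
    and D1: "D1 \<in> F" "D1 = insert y (insert (- v) E)" and D2: "D2 \<in> F" "D2 = insert (- y) E"
    and E: "y \<notin> E" "- y \<notin> E" "v \<notin> E" "- v \<notin> E" and vy: "v \<noteq> y" "v \<noteq> - y"
    and R1: "R1 \<in> F" "v \<in> R1" "y \<in> R1" and R2: "R2 \<in> F" "v \<in> R2" "- y \<in> R2"
    and occ: "\<And>D. D \<in> F \<Longrightarrow> y \<in> D \<Longrightarrow> D = D1 \<or> D = R1" "\<And>D. D \<in> F \<Longrightarrow> - y \<in> D \<Longrightarrow> D = D2 \<or> D = R2"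
    and U: "U \<subseteq> R1 \<union> R2" "v \<notin> U" "U \<inter> E = {}"
  shows "card U \<le> 3"
proof -
  have v0: "v \<noteq> 0" "- v \<notin> R1" "- v \<notin> R2" and y0: "y \<noteq> 0" "- y \<notin> R1" "y \<notin> R2"
    using uh_literal[OF F R1(1,2)] uh_literal[OF F R2(1,2)] uh_literal[OF F R1(1,3)]
      uh_literal[OF F R2(1,3)] by auto
  \<comment> \<open>Making \<open>y\<close> false in an assignment that falsifies \<open>v\<close>
    leads to \<open>R1\<close>, since \<open>D1\<close>, the other clause with \<open>y\<close>,
    contains \<open>- v\<close>.\<close>
  have R1_implied: "R1 - {y} \<subseteq> T" if T: "total_lits T" "v \<in> T" and D: "D \<in> F" "- y \<in> D" "D \<subseteq> T" for T D
  proof -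
    obtain D' where D': "D' \<in> F" "y \<in> D'" "D' \<subseteq> force y T"
      using uh_flip[OF F D(1,2) T(1) D(3)] by auto
    have "- v \<notin> force y T" using total_lits_consistent[OF T] v0 vy by auto
    then have "D' \<noteq> D1" using D' D1(2) by blast
    then have "D' = R1" using occ(1) D' by blast
    then show ?thesis using D' by auto
  qed
  have cl: "clause (insert v D2)"
    using clause_insert[OF uh_clause[OF F D2(1)] v0(1)] E vy unfolding D2(2) by simp
  have "R1 - {y} \<subseteq> insert v D2"
  proof (rule subset_if_implied[OF cl])
    show "0 \<notin> R1 - {y}" using uh_literal[OF F R1(1)] by blast
    show "R1 - {y} \<subseteq> T" if "total_lits T" "insert v D2 \<subseteq> T" for T
      using R1_implied[OF that(1) _ D2(1)] that(2) D2(2) by simp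
  qed
  then have A: "R1 - {y} \<subseteq> insert v E" using y0 unfolding D2(2) by blast
  have B: "R1 - {y} \<subseteq> R2"
  proof (rule subset_if_implied[OF uh_clause[OF F R2(1)]])
    show "0 \<notin> R1 - {y}" using uh_literal[OF F R1(1)] by blast
    show "R1 - {y} \<subseteq> T" if "total_lits T" "R2 \<subseteq> T" for T
      using R1_implied[OF that(1) _ R2(1,3)] that(2) R2(2) by blast
  qed
  \<comment> \<open>This set has at most one element. If \<open>R1\<close> is falsified and some
    \<open>a\<close> in it is true, making \<open>y\<close> true leads to \<open>D2\<close>, so
    \<open>E\<close> lies in \<open>R1\<close> with \<open>- a\<close> added. Two such
    \<open>a\<close> would give \<open>E \<subseteq> R1\<close> and hence
    \<open>D2 \<subseteq> R2\<close>.\<close>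
  let ?S = "R2 - R1 - {- y}"
  have C: "E \<subseteq> insert (- a) R1" if a: "a \<in> ?S" for a
  proof (rule subset_if_implied)
    have a0: "a \<noteq> 0" using uh_literal[OF F R2(1)] a by blast
    then show "clause (insert (- a) R1)"
      using clause_insert[OF uh_clause[OF F R1(1)]] a by simp
    show "0 \<notin> E" using uh_literal[OF F D2(1)] D2(2) by blast
    fix T assume T: "total_lits T" "insert (- a) R1 \<subseteq> T"
    then have "R1 \<subseteq> T" by blast
    then obtain D where D: "D \<in> F" "- y \<in> D" "D \<subseteq> force (- y) T"
      using uh_flip[OF F R1(1,3) T(1)] by blast
    have "a \<notin> T" using total_lits_consistent[OF T(1), of a] T(2) a0 by blast
    then have "a \<notin> force (- y) T" using a by auto
    then have "D \<noteq> R2" using D a by blast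
    then have "D = D2" using occ(2) D by blast
    then show "E \<subseteq> T" using D E unfolding D2(2) by auto
  qed
  have "a = b" if ab: "a \<in> ?S" "b \<in> ?S" for a b
  proof (rule ccontr)
    assume "a \<noteq> b"
    then have "E \<subseteq> R1" using C[OF ab(1)] C[OF ab(2)] by auto
    then have "D2 \<subseteq> R2" using B E R2 unfolding D2(2) by blast
    then have "D2 = R2" using uh_subset_eq[OF F D2(1) R2(1)] by blast
    then show False using R2(2) E vy unfolding D2(2) by blast
  qed
  moreover have finS: "finite ?S" using uh_clause[OF F R2(1)] unfolding clause_def by blast
  ultimately have S: "card ?S \<le> 1" by (metis card_le_Suc0_iff_eq One_nat_def)
  have "U \<subseteq> {y, - y} \<union> ?S" using U A by blast
  then have "card U \<le> card ({y, - y} \<union> ?S)" using finS by (intro card_mono) auto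
  also have "\<dots> \<le> card {y, - y} + card ?S" by (rule card_Un_le)
  also have "\<dots> \<le> 3" using S card_insert_le_m1[of 2 "{- y}" y] by simp
  finally show ?thesis .
qed

text \<open>Pigeonhole: there are more unique literals than variables.\<close>

lemma complementary_unique_lits:
  assumes F: "unsat_hitting F" and n: "nvars F > 0" and d: "deficiency F = 1"
  obtains y where "y \<in> unique_lits F" "- y \<in> unique_lits F"
proof -
  have "unique_lits F \<subseteq> \<Union>F" unfolding subset_iff unique_lits_iff by blast
  then have "abs ` unique_lits F \<subseteq> vars F" unfolding vars_def by (rule image_mono)
  then have "card (abs ` unique_lits F) \<le> nvars F"
    unfolding nvars_def by (rule card_mono[OF finite_vars[OF F]])
  then have "\<not> inj_on abs (unique_lits F)"
    using nvars_lt_unique_lits[OF assms] card_image by fastforce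
  then obtain a b where ab: "a \<in> unique_lits F" "b \<in> unique_lits F" "\<bar>a\<bar> = \<bar>b\<bar>" "a \<noteq> b"
    unfolding inj_on_def by blast
  then have "b = - a" by (auto simp: abs_eq_iff)
  then show ?thesis using that ab by blast
qed

text \<open>Restricting to a literal \<open>v\<close> of degree 2 leaves deficiency 1, where
  complementary unique literals yield a full pair on some \<open>y\<close>. Irreducibility forbids
  such a pair in \<open>F\<close>, so exactly one of its clauses came from a clause with
  \<open>- v\<close>. Then the restriction has at most 3 unique literals, hence at most 2
  variables.\<close>

lemma deficiency_2_irreducible_nvars:
  assumes F: "unsat_hitting F" and irr: "clause_irreducible F" and d: "deficiency F = 2"
  shows "nvars F \<le> 3"
proof (cases "nvars F > 0")
  case True
  have nF: "unique_lits F = {}" using irreducible_nonsingular[OF F irr] d nonsingular_iff[OF F] by simp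
  obtain v where v: "v \<in> \<Union>F" "int (ldeg F v) \<le> deficiency F"
    "vars (restrict_lit F v) = vars F - {\<bar>v\<bar>}"
    using low_degree_literal[OF F True] .
  have v0: "v \<noteq> 0" using v(1) uh_literal[OF F] by blast
  have "ldeg F v \<noteq> 1" using nF unfolding unique_lits_def by blast
  then have deg: "ldeg F v = 2" using ldeg_pos[OF F v(1)] v(2) d by linarith
  let ?R = "restrict_lit F v"
  have UR: "unsat_hitting ?R" using restrict_unsat_hitting[OF F v0] .
  have dR: "deficiency ?R = 1" using deficiency_restrict[OF F v(1,3)] deg d by simp
  note nR = nvars_restrict[OF F v(1,3)]
  show ?thesis
  proof (cases "nvars ?R > 0")
    case True
    obtain y where y: "y \<in> unique_lits ?R" "- y \<in> unique_lits ?R"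
      using complementary_unique_lits[OF UR True dR] .
    have UR': "u \<noteq> v \<and> u \<noteq> - v \<and> (\<exists>H\<in>F. v \<in> H \<and> u \<in> H)" if "u \<in> unique_lits ?R" for u
      using restrict_unique_lits_cases[OF F v0 that] nF by auto
    obtain R1 where R1: "R1 \<in> F" "v \<in> R1" "y \<in> R1" using UR'[OF y(1)] by blast
    obtain R2 where R2: "R2 \<in> F" "v \<in> R2" "- y \<in> R2" using UR'[OF y(2)] by blast
    have ny: "- y \<notin> R1" "y \<notin> R2" using uh_literal[OF F R1(1,3)] uh_literal[OF F R2(1,3)] by auto
    then have "R1 \<noteq> R2" using R1 by blast
    then have "{R1, R2} = {D \<in> F. v \<in> D}"
      using R1 R2 deg uh_finite[OF F] unfolding ldeg_def by (intro card_subset_eq) auto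
    then have occ_v: "D = R1 \<or> D = R2" if "D \<in> F" "v \<in> D" for D using that by blast
    obtain E1 where E1: "E1 \<in> ?R" "y \<in> E1" and uE1: "\<And>D. D \<in> ?R \<Longrightarrow> y \<in> D \<Longrightarrow> D = E1"
      using unique_lits_obtain[OF y(1)] by blast
    obtain E2 where E2: "E2 \<in> ?R" "- y \<in> E2" and uE2: "\<And>D. D \<in> ?R \<Longrightarrow> - y \<in> D \<Longrightarrow> D = E2"
      using unique_lits_obtain[OF y(2)] by blast
    define E where "E = E1 - {y}"
    have y0: "y \<noteq> 0" "- y \<notin> E1" "y \<notin> E2" using uh_literal[OF UR E1] uh_literal[OF UR E2] by auto
    have "E1 - {y} \<subseteq> E2" using unique_lit_subset[OF UR y(1) E1 E2] .
    moreover have "E2 - {- y} \<subseteq> E1"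
      using unique_lit_subset[OF UR y(2) E2 E1(1)] E1(2) by simp
    ultimately have E1': "E1 = insert y E" and E2': "E2 = insert (- y) E"
      unfolding E_def using E1 E2 y0 by auto
    have Ey: "y \<notin> E" "- y \<notin> E" using y0 unfolding E_def by auto
    obtain D1 where D1: "D1 \<in> F" "v \<notin> D1" "E1 = D1 - {- v}"
      using E1(1) unfolding restrict_lit_def by blast
    obtain D2 where D2: "D2 \<in> F" "v \<notin> D2" "E2 = D2 - {- v}"
      using E2(1) unfolding restrict_lit_def by blast
    have vy: "v \<noteq> y" "v \<noteq> - y" "- v \<noteq> y" "- v \<noteq> - y"
      using UR'[OF y(1)] by auto
    have Ev: "v \<notin> E" "- v \<notin> E" using D1 unfolding E_def by auto
    have inj: "C = D" if "C \<in> F" "v \<notin> C" "D \<in> F" "v \<notin> D" "C - {- v} = D - {- v}" for C D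
      using inj_onD[OF inj_restrict[OF F v0]] that by simp
    have occ1: "D = D1 \<or> D = R1" if D: "D \<in> F" "y \<in> D" for D
    proof (cases "v \<in> D")
      case True
      then show ?thesis using occ_v D ny by blast
    next
      case False
      then have "D - {- v} \<in> ?R" "y \<in> D - {- v}" using D vy unfolding restrict_lit_def by auto
      then have "D - {- v} = D1 - {- v}" using uE1 D1(3) by blast
      then show ?thesis using inj D D1 False by blast
    qed
    have occ2: "D = D2 \<or> D = R2" if D: "D \<in> F" "- y \<in> D" for D
    proof (cases "v \<in> D")
      case True
      then show ?thesis using occ_v D ny by blast
    next
      case False
      then have "D - {- v} \<in> ?R" "- y \<in> D - {- v}" using D vy unfolding restrict_lit_def by auto
      then have "D - {- v} = D2 - {- v}" using uE2 D2(3) by blast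
      then show ?thesis using inj D D2 False by blast
    qed
    have no_pair: False
      if "insert y E' \<in> F" "insert (- y) E' \<in> F" "y \<notin> E'" "- y \<notin> E'" for E'
    proof -
      have "nontrivial_factor F {insert y E', insert (- y) E'}"
        using full_pair_factor[OF F _ that] d by simp
      then show False using irr unfolding nontrivial_factor_def clause_irreducible_def by blast
    qed
    let ?U = "unique_lits ?R"
    have U1: "?U \<subseteq> R1 \<union> R2" "v \<notin> ?U" using UR' occ_v by blast+
    have U2: "?U \<inter> E = {}"
    proof (rule ccontr)
      assume "?U \<inter> E \<noteq> {}"
      then obtain u where u: "u \<in> ?U" "u \<in> E" by blast
      then have "u \<in> E1" "u \<in> E2" using E1' E2' by auto
      then have "E1 = E2" using u(1) E1(1) E2(1) unfolding unique_lits_iff by metis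
      then show False using E1 y0 by blast
    qed
    have form: "D1 = insert y E \<or> D1 = insert y (insert (- v) E)"
      "D2 = insert (- y) E \<or> D2 = insert (- y) (insert (- v) E)"
      using D1(3) D2(3) E1' E2' by blast+
    have "card ?U \<le> 3"
    proof (cases "- v \<in> D1"; cases "- v \<in> D2")
      assume "- v \<in> D1" "- v \<in> D2"
      then have "D1 = insert y (insert (- v) E)" "D2 = insert (- y) (insert (- v) E)"
        using form Ev vy by auto
      then show ?thesis using no_pair[of "insert (- v) E"] D1 D2 Ey vy by auto
    next
      assume "- v \<notin> D1" "- v \<notin> D2"
      then have "D1 = insert y E" "D2 = insert (- y) E" using form by auto
      then show ?thesis using no_pair[of E] D1 D2 Ey by auto
    next
      assume "- v \<in> D1" "- v \<notin> D2"
      then have f: "D1 = insert y (insert (- v) E)" "D2 = insert (- y) E" using form Ev vy by auto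
      show ?thesis
        by (rule mixed_pair_unique_lits[OF F D1(1) f(1) D2(1) f(2) Ey Ev vy(1,2) R1 R2 occ1 occ2 U1 U2])
    next
      \<comment> \<open>The previous case with \<open>- y\<close> in place of \<open>y\<close>,
        exchanging \<open>D1\<close> with \<open>D2\<close> and \<open>R1\<close> with
        \<open>R2\<close>.\<close>
      assume "- v \<notin> D1" "- v \<in> D2"
      then have f: "D2 = insert (- y) (insert (- v) E)" "D1 = insert (- (- y)) E" using form Ev vy by auto
      have m: "- (- y) \<notin> E" "v \<noteq> - (- y)" "- (- y) \<in> R1" using Ey vy R1 by auto
      have occ: "D = D1 \<or> D = R1" if "D \<in> F" "- (- y) \<in> D" for D using occ1 that by simp
      have U1': "?U \<subseteq> R2 \<union> R1" using U1 by blast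
      show ?thesis
        by (rule mixed_pair_unique_lits[OF F D2(1) f(1) D1(1) f(2) Ey(2) m(1) Ev vy(2) m(2) R2 R1(1,2) m(3)
            occ2 occ U1' U1(2) U2])
    qed
    then show ?thesis using nvars_lt_unique_lits[OF UR True dR] nR by simp
  qed (use nR in simp)
qed simp

subsection \<open>Extremal examples\<close>

text \<open>The binary clauses are a cycle of implications forcing \<open>a\<close>,
  \<open>b\<close>, \<open>c\<close> to be equal; the other two exclude all false and all true. With
  deficiency 2 and 3 variables this attains \<open>4 * k - 5\<close>.\<close>

lemma triangle_nonsingular_unsat_hitting:
  fixes a b c :: int
  assumes abc: "0 < a" "a < b" "b < c"
  defines "F \<equiv> {{a, b, c}, {- a, - b, - c}, {- a, b}, {- b, c}, {- c, a}}"
  shows "unsat_hitting F" "nonsingular F" "card F = 5" "vars F = {a, b, c}"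
proof -
  have cs: "clause_set F" unfolding F_def clause_set_def clause_def using abc by auto
  have "\<not> satisfiable F"
    unfolding unsat_iff_total[OF cs]
  proof (intro allI impI)
    fix T assume "total_lits T"
    then have "- a \<in> T \<longleftrightarrow> a \<notin> T" "- b \<in> T \<longleftrightarrow> b \<notin> T" "- c \<in> T \<longleftrightarrow> c \<notin> T"
      using abc unfolding total_lits_def by auto
    then show "\<exists>C\<in>F. C \<subseteq> T" unfolding F_def by auto
  qed
  moreover have "hitting F" unfolding F_def hitting_def by auto
  ultimately show UF: "unsat_hitting F" using cs unfolding unsat_hitting_def by blast
  have "a \<notin> {- a, - b, - c}" "b \<notin> {- a, - b, - c}" "c \<notin> {- a, - b, - c}" using abc by auto
  then have distinct_neg: "{- a, - b, - c} \<noteq> {- a, b}" "{- a, - b, - c} \<noteq> {- b, c}"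
    "{- a, - b, - c} \<noteq> {- c, a}" "{a, b, c} \<noteq> {- a, - b, - c}"
    by blast+
  have distinct: "{a, b, c} \<noteq> {- c, a}" "{a, b, c} \<noteq> {- a, b}" "{a, b, c} \<noteq> {- b, c}"
    "{- a, b} \<noteq> {- b, c}" "{- a, b} \<noteq> {- c, a}" "{- b, c} \<noteq> {- c, a}"
    using abc by auto
  have "z \<notin> unique_lits F" for z
  proof
    assume "z \<in> unique_lits F"
    then obtain H where H: "H \<in> F" "z \<in> H" and u: "\<And>D. D \<in> F \<Longrightarrow> z \<in> D \<Longrightarrow> D = H"
      using unique_lits_obtain by blast
    have eq: "C = D" if "C \<in> F" "D \<in> F" "z \<in> C" "z \<in> D" for C D using u that by blast
    have z: "z \<in> {a, b, c, - a, - b, - c}" using H unfolding F_def by blast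
    have m: "{a, b, c} \<in> F" "{- a, - b, - c} \<in> F" "{- a, b} \<in> F" "{- b, c} \<in> F" "{- c, a} \<in> F"
      unfolding F_def by auto
    have "z \<noteq> a" using eq[OF m(1,5)] distinct(1) by blast
    moreover have "z \<noteq> b" using eq[OF m(1,3)] distinct(2) by blast
    moreover have "z \<noteq> c" using eq[OF m(1,4)] distinct(3) by blast
    moreover have "z \<noteq> - a" using eq[OF m(2,3)] distinct_neg(1) by blast
    moreover have "z \<noteq> - b" using eq[OF m(2,4)] distinct_neg(2) by blast
    moreover have "z \<noteq> - c" using eq[OF m(2,5)] distinct_neg(3) by blast
    ultimately show False using z by blast
  qed
  then show "nonsingular F" using nonsingular_iff[OF UF] by blast
  show "card F = 5" unfolding F_def using distinct distinct_neg by simp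
  show "vars F = {a, b, c}" unfolding F_def vars_def using abc by auto
qed

lemma insert_image_no_unique:
  assumes F: "unsat_hitting F" "unique_lits F = {}" "card F \<ge> 2" and w: "w \<notin> \<Union>F"
    and H: "H \<in> insert w ` F" "z \<in> H"
  shows "\<exists>D\<in>insert w ` F. z \<in> D \<and> D \<noteq> H"
proof -
  obtain C where C: "C \<in> F" "H = insert w C" using H by blast
  have "\<exists>D\<in>F. D \<noteq> C \<and> z \<in> insert w D"
  proof (cases "z = w")
    case True
    have "F \<noteq> {C}" using F(3) by auto
    then show ?thesis using True C by blast
  next
    case False
    then have "z \<in> C" using H C by blast
    moreover have "z \<notin> unique_lits F" using F(2) by simp
    ultimately show ?thesis using C(1) unfolding unique_lits_iff by blast
  qed
  then obtain D where D: "D \<in> F" "D \<noteq> C" "z \<in> insert w D" by blast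
  moreover have "w \<notin> D" "w \<notin> C" using D C w by auto
  then have "insert w D \<noteq> insert w C" using D(2) by (simp add: insert_ident)
  ultimately show ?thesis using C by blast
qed

text \<open>The value of \<open>v\<close> decides which part supplies the falsified clause. With at
  least two clauses in each part, neither \<open>v\<close> nor \<open>- v\<close> is unique.\<close>

lemma join_nonsingular_unsat_hitting:
  assumes F: "unsat_hitting F" "nonsingular F" "card F \<ge> 2"
    and G: "unsat_hitting G" "nonsingular G" "card G \<ge> 2"
    and v: "v > 0" "v \<notin> vars F" "v \<notin> vars G"
  defines "K \<equiv> insert v ` F \<union> insert (- v) ` G"
  shows "unsat_hitting K" "nonsingular K" "card K = card F + card G"
    "vars K = insert v (vars F \<union> vars G)"
proof -
  have nF: "v \<notin> \<Union>F" "- v \<notin> \<Union>F" using abs_mem_vars_iff[OF F(1)] v by (metis abs_minus abs_of_pos)+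
  have nG: "v \<notin> \<Union>G" "- v \<notin> \<Union>G" using abs_mem_vars_iff[OF G(1)] v by (metis abs_minus abs_of_pos)+
  show UK: "unsat_hitting K"
    unfolding unsat_hitting_iff_partition
  proof (intro conjI allI impI)
    have "clause (insert v C)" if "C \<in> F" for C
    proof -
      have "- v \<notin> C" using nF(2) that by blast
      then show ?thesis using clause_insert[OF uh_clause[OF F(1) that]] v(1) by simp
    qed
    moreover have "clause (insert (- v) C)" if "C \<in> G" for C
    proof -
      have "v \<notin> C" using nG(1) that by blast
      then show ?thesis using clause_insert[OF uh_clause[OF G(1) that]] v(1) by simp
    qed
    ultimately show "clause_set K"
      unfolding K_def clause_set_def using uh_finite[OF F(1)] uh_finite[OF G(1)] by auto
    fix T assume T: "total_lits T"
    have vT: "- v \<in> T \<longleftrightarrow> v \<notin> T" using T v unfolding total_lits_def by simp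
    show "\<exists>!C. C \<in> K \<and> C \<subseteq> T"
    proof (cases "v \<in> T")
      case True
      obtain C where C: "C \<in> F" "C \<subseteq> T" using uh_ex[OF F(1) T] .
      show ?thesis
      proof (rule ex1I)
        show "insert v C \<in> K \<and> insert v C \<subseteq> T" unfolding K_def using C True by blast
        fix D assume D: "D \<in> K \<and> D \<subseteq> T"
        then obtain D' where "D' \<in> F" "D = insert v D'" unfolding K_def using vT True by blast
        then show "D = insert v C" using uh_unique[OF F(1) T, of D' C] C D by blast
      qed
    next
      case False
      obtain C where C: "C \<in> G" "C \<subseteq> T" using uh_ex[OF G(1) T] .
      show ?thesis
      proof (rule ex1I)
        show "insert (- v) C \<in> K \<and> insert (- v) C \<subseteq> T" unfolding K_def using C False vT by blast
        fix D assume D: "D \<in> K \<and> D \<subseteq> T"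
        then obtain D' where "D' \<in> G" "D = insert (- v) D'" unfolding K_def using vT False by blast
        then show "D = insert (- v) C" using uh_unique[OF G(1) T, of D' C] C D by blast
      qed
    qed
  qed
  have uF: "unique_lits F = {}" and uG: "unique_lits G = {}" using nonsingular_iff F G by auto
  have "z \<notin> unique_lits K" for z
  proof
    assume "z \<in> unique_lits K"
    then obtain H where H: "H \<in> K" "z \<in> H" and u: "\<And>D. D \<in> K \<Longrightarrow> z \<in> D \<Longrightarrow> D = H"
      using unique_lits_obtain by blast
    from H(1) consider "H \<in> insert v ` F" | "H \<in> insert (- v) ` G" unfolding K_def by blast
    then have "\<exists>D\<in>K. z \<in> D \<and> D \<noteq> H"
    proof cases
      case 1
      then show ?thesis
        using insert_image_no_unique[OF F(1) uF F(3) nF(1) 1 H(2)] unfolding K_def by (metis UnI1)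
    next
      case 2
      then show ?thesis
        using insert_image_no_unique[OF G(1) uG G(3) nG(2) 2 H(2)] unfolding K_def by (metis UnI2)
    qed
    then show False using u by metis
  qed
  then show "nonsingular K" using nonsingular_iff[OF UK] by blast
  have "insert v ` F \<inter> insert (- v) ` G = {}"
  proof (rule ccontr)
    assume "insert v ` F \<inter> insert (- v) ` G \<noteq> {}"
    then obtain C D where CD: "D \<in> G" "insert v C = insert (- v) D" by blast
    have "v \<in> insert (- v) D" using CD(2) by blast
    moreover have "v \<notin> D" using nG(1) CD(1) by blast
    ultimately show False using v(1) by simp
  qed
  moreover have "card (insert v ` F) = card F"
    using nF(1) by (intro card_image inj_onI) (meson UnionI insert_ident)
  moreover have "card (insert (- v) ` G) = card G"
    using nG(2) by (intro card_image inj_onI) (meson UnionI insert_ident)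
  ultimately show "card K = card F + card G"
    unfolding K_def using uh_finite[OF F(1)] uh_finite[OF G(1)] by (simp add: card_Un_disjoint)
  have "F \<noteq> {}" "G \<noteq> {}" using F(3) G(3) by auto
  then have "\<Union>K = {v, - v} \<union> \<Union>F \<union> \<Union>G" unfolding K_def by blast
  then show "vars K = insert v (vars F \<union> vars G)" unfolding vars_def using v by (simp add: image_Un)
qed

lemma nonsingular_4k_minus_5:
  assumes "k \<ge> 2"
  shows "\<exists>F. unsat_hitting F \<and> nonsingular F \<and> deficiency F = int k \<and> nvars F = 4 * k - 5"
  using assms
proof (induction k rule: dec_induct)
  case base
  let ?F = "{{1, 2, 3}, {- 1, - 2, - 3}, {- 1, 2}, {- 2, 3}, {- 3, 1}} :: int set set"
  have "unsat_hitting ?F" "nonsingular ?F" "card ?F = 5" "vars ?F = {1, 2, 3}"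
    using triangle_nonsingular_unsat_hitting[of 1 2 3] by simp_all
  then show ?case by (intro exI[of _ ?F]) (simp add: deficiency_def nvars_def)
next
  case (step k)
  then obtain F where F: "unsat_hitting F" "nonsingular F" "deficiency F = int k" "nvars F = 4 * k - 5"
    by blast
  \<comment> \<open>Everything above \<open>m\<close> is fresh. Joining with a triangle on three
    fresh variables through a fourth adds 4 variables and 5 clauses, so the deficiency grows by
    1.\<close>
  define m where "m = Max (insert 0 (vars F))"
  have m: "u \<le> m" if "u \<in> vars F" for u
    unfolding m_def using that finite_vars[OF F(1)] by auto
  have m0: "m \<ge> 0" unfolding m_def using finite_vars[OF F(1)] by simp
  define G where "G = {{m + 1, m + 2, m + 3}, {- (m + 1), - (m + 2), - (m + 3)},
    {- (m + 1), m + 2}, {- (m + 2), m + 3}, {- (m + 3), m + 1}}"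
  have G: "unsat_hitting G" "nonsingular G" "card G = 5" "vars G = {m + 1, m + 2, m + 3}"
    unfolding G_def using triangle_nonsingular_unsat_hitting[of "m + 1" "m + 2" "m + 3"] m0 by simp_all
  have cF: "int (card F) = 5 * int k - 5"
    using F(3,4) step(1) unfolding deficiency_def by (simp add: of_nat_diff)
  define v where "v = m + 4"
  define K where "K = insert v ` F \<union> insert (- v) ` G"
  have vn: "v > 0" "v \<notin> vars F" "v \<notin> vars G" using m0 m[of v] G(4) unfolding v_def by auto
  have c2: "card F \<ge> 2" "card G \<ge> 2" using cF step(1) G(3) by linarith+
  note K = join_nonsingular_unsat_hitting[OF F(1,2) c2(1) G(1,2) c2(2) vn, folded K_def]
  have "vars F \<inter> vars G = {}" using m G(4) by fastforce
  moreover have "card (vars G) = 3" unfolding G(4) by simp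
  ultimately have "nvars K = nvars F + 4"
    unfolding nvars_def K(4) using vn finite_vars[OF F(1)] finite_vars[OF G(1)]
    by (simp add: card_Un_disjoint)
  then have "nvars K = 4 * Suc k - 5" "deficiency K = int (Suc k)"
    using F(4) step(1) cF K(3) G(3) unfolding deficiency_def by (auto simp: of_nat_diff)
  then show ?case using K(1,2) by blast
qed

subsection \<open>Reduction to nfs-irreducible clause-sets\<close>

lemma SUP_enat_finite_iff:
  "(SUP x\<in>S. enat (g x)) < \<infinity> \<longleftrightarrow> (\<exists>M. \<forall>x\<in>S. g x \<le> M)"
proof
  assume "(SUP x\<in>S. enat (g x)) < \<infinity>"
  then obtain M where M: "(SUP x\<in>S. enat (g x)) = enat M" by (metis enat_ord_simps(4) not_infinity_eq)
  have "g x \<le> M" if "x \<in> S" for x using SUP_upper[OF that, of "\<lambda>x. enat (g x)"] M by simp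
  then show "\<exists>M. \<forall>x\<in>S. g x \<le> M" by blast
next
  assume "\<exists>M. \<forall>x\<in>S. g x \<le> M"
  then obtain M where "\<forall>x\<in>S. g x \<le> M" by blast
  then have "(SUP x\<in>S. enat (g x)) \<le> enat M" by (intro SUP_least) simp
  then show "(SUP x\<in>S. enat (g x)) < \<infinity>" using le_less_trans by fastforce
qed

lemma nonsingular_bound_exists:
  assumes irr: "\<And>k. k \<ge> 3 \<Longrightarrow> \<exists>M. \<forall>F. nfs_irreducible F \<longrightarrow> deficiency F = k \<longrightarrow> int (nvars F) \<le> M"
    and k: "k \<ge> 1"
  shows "\<exists>M \<ge> - 1. nonsingular_bound k M"
  using k
proof (induction "nat k" arbitrary: k rule: less_induct)
  case less
  show ?case
  proof (cases "k = 1")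
    case True
    then show ?thesis using nonsingular_bound_1 by blast
  next
    case False
    then have k2: "k \<ge> 2" using less.prems by simp
    have "\<exists>b. \<forall>F. nfs_irreducible F \<longrightarrow> deficiency F = k \<longrightarrow> int (nvars F) \<le> b"
    proof (cases "k = 2")
      case True
      have "int (nvars F) \<le> 3" if "nfs_irreducible F" "deficiency F = k" for F
        using deficiency_2_irreducible_nvars[of F] that True unfolding nfs_irreducible_def by simp
      then show ?thesis by blast
    qed (use irr k2 in auto)
    then obtain b where b: "\<And>F. nfs_irreducible F \<Longrightarrow> deficiency F = k \<Longrightarrow> int (nvars F) \<le> b" by blast
    have "\<forall>j\<in>{1..<k}. \<exists>M. M \<ge> - 1 \<and> nonsingular_bound j M" using less.hyps by auto
    then obtain f where f: "\<forall>j\<in>{1..<k}. f j \<ge> - 1 \<and> nonsingular_bound j (f j)" by metis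
    define s where "s = (\<Sum>j\<in>{1..<k}. \<bar>f j\<bar>)"
    have s: "f j \<le> s" if "1 \<le> j" "j < k" for j
      using member_le_sum[of j "{1..<k}" "\<lambda>j. \<bar>f j\<bar>"] that unfolding s_def by simp
    have s0: "s \<ge> 0" unfolding s_def by (simp add: sum_nonneg)
    define M where "M = \<bar>b\<bar> + 2 * s + 1 + 4 * k"
    have "reducible_bound k f M"
      unfolding reducible_bound_def
    proof (intro conjI allI impI)
      fix a b' t :: int assume "1 \<le> a" "a < k" "1 \<le> b'" "b' < k" "0 \<le> t" "a + b' + t = k + 1"
      then show "f a + f b' + 1 + 4 * t \<le> M" using s[of a] s[of b'] unfolding M_def by linarith
    qed (use f in auto)
    then have "nonsingular_bound k M"
    proof (rule nonsingular_bound_step[OF k2])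
      fix F assume "nfs_irreducible F" "deficiency F = k"
      then show "int (nvars F) \<le> M" using b[of F] s0 k2 unfolding M_def by linarith
    qed
    moreover have "M \<ge> - 1" using s0 k2 unfolding M_def by linarith
    ultimately show ?thesis by blast
  qed
qed

lemma nonsingular_bound_4k_minus_5:
  assumes irr: "\<And>k F. k \<ge> 3 \<Longrightarrow> nfs_irreducible F \<Longrightarrow> deficiency F = k \<Longrightarrow> int (nvars F) \<le> 4 * k - 5"
    and k: "k \<ge> 1"
  shows "nonsingular_bound k (4 * k - 5)"
  using k
proof (induction "nat k" arbitrary: k rule: less_induct)
  case less
  show ?case
  proof (cases "k = 1")
    case True
    then show ?thesis using nonsingular_bound_1 by simp
  next
    case False
    then have k2: "k \<ge> 2" using less.prems by simp
    \<comment> \<open>This holds with equality: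
      \<open>(4 * a - 5) + (4 * b - 5) + 1 + 4 * s = 4 * (k + 1) - 9\<close>.\<close>
    have "reducible_bound k (\<lambda>j. 4 * j - 5) (4 * k - 5)"
      unfolding reducible_bound_def using less.hyps by auto
    then show ?thesis
    proof (rule nonsingular_bound_step[OF k2])
      fix F assume F: "nfs_irreducible F" "deficiency F = k"
      show "int (nvars F) \<le> 4 * k - 5"
      proof (cases "k = 2")
        case True
        then show ?thesis
          using deficiency_2_irreducible_nvars[of F] F unfolding nfs_irreducible_def by simp
      qed (use irr k2 F in auto)
    qed
  qed
qed

theorem corollary10:
  shows "((\<forall>k::nat. k \<ge> 1 \<longrightarrow> max_nvars k < \<infinity>) \<longleftrightarrow>
      (\<forall>k::nat. k \<ge> 3 \<longrightarrow>
        (SUP F\<in>{F. nfs_irreducible F \<and> clause_irreducible F \<and> unsat_hitting F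
                     \<and> deficiency F = int k}. enat (nvars F)) < \<infinity>))
    \<and>
    ((\<forall>k::nat. k \<ge> 2 \<longrightarrow> max_nvars k = enat (4 * k - 5)) \<longleftrightarrow>
      (\<forall>k::nat. k \<ge> 3 \<longrightarrow>
        (\<forall>F. nfs_irreducible F \<and> clause_irreducible F \<and> unsat_hitting F
               \<and> deficiency F = int k \<longrightarrow> nvars F \<le> 4 * k - 5)))"
proof -
  let ?N = "\<lambda>k. {F. unsat_hitting F \<and> nonsingular F \<and> deficiency F = int k}"
  let ?I = "\<lambda>k. {F. nfs_irreducible F \<and> clause_irreducible F \<and> unsat_hitting F \<and> deficiency F = int k}"
  have sub: "?I k \<subseteq> ?N k" if "k \<ge> 3" for k using irreducible_nonsingular that by auto
  have nfs_I: "F \<in> ?I (nat k)" if "nfs_irreducible F" "deficiency F = k" "k \<ge> 3" for F and k :: int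
    using that unfolding nfs_irreducible_def by simp
  have "(\<forall>k::nat. k \<ge> 1 \<longrightarrow> (\<exists>M. \<forall>F\<in>?N k. nvars F \<le> M)) \<longleftrightarrow>
    (\<forall>k::nat. k \<ge> 3 \<longrightarrow> (\<exists>M. \<forall>F\<in>?I k. nvars F \<le> M))" (is "?L \<longleftrightarrow> ?R")
  proof
    assume L: ?L
    show ?R
    proof (intro allI impI)
      fix k :: nat assume k: "k \<ge> 3"
      then obtain M where "\<forall>F\<in>?N k. nvars F \<le> M" using L by fastforce
      then show "\<exists>M. \<forall>F\<in>?I k. nvars F \<le> M" using sub[OF k] by blast
    qed
  next
    assume R: ?R
    have irr: "\<exists>M. \<forall>F. nfs_irreducible F \<longrightarrow> deficiency F = k \<longrightarrow> int (nvars F) \<le> M" if k: "k \<ge> 3" for k :: int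
    proof -
      have "nat k \<ge> 3" using k by simp
      then obtain M where M: "\<forall>F\<in>?I (nat k). nvars F \<le> M" using R by blast
      have "int (nvars F) \<le> int M" if "nfs_irreducible F" "deficiency F = k" for F
        using M nfs_I[OF that k] by simp
      then show ?thesis by blast
    qed
    show ?L
    proof (intro allI impI)
      fix k :: nat assume "k \<ge> 1"
      then obtain M where M: "nonsingular_bound (int k) M"
        using nonsingular_bound_exists[OF irr, of "int k"] by auto
      \<comment> \<open>\<open>M\<close> may be negative and speaks only of clause-sets with
        variables; \<open>nat\<close> raises it to 0, which covers the others.\<close>
      have "nvars F \<le> nat M" if "F \<in> ?N k" for F
        using M that unfolding nonsingular_bound_def by (cases "nvars F > 0") auto
      then show "\<exists>M. \<forall>F\<in>?N k. nvars F \<le> M" by blast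
    qed
  qed
  moreover have "(\<forall>k::nat. k \<ge> 2 \<longrightarrow> max_nvars k = enat (4 * k - 5)) \<longleftrightarrow>
      (\<forall>k::nat. k \<ge> 3 \<longrightarrow> (\<forall>F. F \<in> ?I k \<longrightarrow> nvars F \<le> 4 * k - 5))" (is "?L \<longleftrightarrow> ?R")
  proof
    assume L: ?L
    show ?R
    proof (intro allI impI)
      fix k :: nat and F assume k: "k \<ge> 3" and F: "F \<in> ?I k"
      have "enat (nvars F) \<le> max_nvars k"
        unfolding max_nvars_def using sub[OF k] F by (intro SUP_upper) blast
      also have "\<dots> = enat (4 * k - 5)" using L k by simp
      finally show "nvars F \<le> 4 * k - 5" by simp
    qed
  next
    assume R: ?R
    have irr: "int (nvars F) \<le> 4 * k - 5" if "k \<ge> 3" "nfs_irreducible F" "deficiency F = k" for k F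
    proof -
      have "nat k \<ge> 3" using that(1) by simp
      then have "nvars F \<le> 4 * nat k - 5" using R nfs_I[OF that(2,3,1)] by blast
      then show ?thesis using that(1) by linarith
    qed
    show ?L
    proof (intro allI impI)
      fix k :: nat assume k: "k \<ge> 2"
      have B: "nonsingular_bound (int k) (4 * int k - 5)"
        by (rule nonsingular_bound_4k_minus_5[OF irr]) (use k in simp_all)
      have "nvars F \<le> 4 * k - 5" if "F \<in> ?N k" for F
      proof (cases "nvars F > 0")
        case True
        then have "int (nvars F) \<le> 4 * int k - 5" using B that unfolding nonsingular_bound_def by blast
        then show ?thesis by linarith
      qed simp
      then have "max_nvars k \<le> enat (4 * k - 5)" unfolding max_nvars_def by (intro SUP_least) simp
      moreover obtain F where F: "F \<in> ?N k" "nvars F = 4 * k - 5"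
        using nonsingular_4k_minus_5[OF k] by blast
      have "enat (4 * k - 5) \<le> max_nvars k"
        unfolding max_nvars_def F(2)[symmetric] using F(1) by (rule SUP_upper)
      ultimately show "max_nvars k = enat (4 * k - 5)" by simp
    qed
  qed
  ultimately show ?thesis unfolding max_nvars_def SUP_enat_finite_iff mem_Collect_eq by simp
qed

end
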